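(* Let $D$ be the random $n$-vertex directed graph in which between every pair of vertices there is exactly one arc, oriented in either direction with probability $1/2$, independently. Then asymptotically almost surely (as $n\to\infty$), $\nu_t(D)=n^2/6+o(n^2)$ and $\tau_t(D)=n^2/4-o(n^2)$.
   Context: A directed triangle is a triple of arcs $uv,vw,wu$. $\nu_t(D)$ is the maximum number of pairwise arc-disjoint directed triangles in $D$; $\tau_t(D)$ is the minimum number of arcs whose removal leaves no directed triangle. *)

theory Defs
  imports "HOL-Probability.Probability" "HOL-Library.Landau_Symbols" "HOL-Library.Disjoint_Sets"
    "Graph_Theory.Pair_Digraph"
begin

definition directed_triangles :: "'a pair_pre_digraph \<Rightarrow> ('a \<times> 'a) set set" where
  "directed_triangles D =
     {{(u, v), (v, w), (w, u)} | u v w.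
        u \<noteq> v \<and> v \<noteq> w \<and> w \<noteq> u \<and> (u, v) \<in> parcs D \<and> (v, w) \<in> parcs D \<and> (w, u) \<in> parcs D}"

text \<open>The maximum and the minimum below are meaningful for finitely many arcs.\<close>

definition nu_t :: "'a pair_pre_digraph \<Rightarrow> nat" where
  "nu_t D = Max {card T | T. T \<subseteq> directed_triangles D \<and> disjoint T}"

definition tau_t :: "'a pair_pre_digraph \<Rightarrow> nat" where
  "tau_t D = Min {card F | F. F \<subseteq> parcs D \<and> directed_triangles (D\<lparr>parcs := parcs D - F\<rparr>) = {}}"

definition vertex_pairs :: "nat \<Rightarrow> (nat \<times> nat) set" where
  "vertex_pairs n = {(i, j). i < j \<and> j < n}"

definition orientation :: "nat \<Rightarrow> (nat \<times> nat \<Rightarrow> bool) \<Rightarrow> nat pair_pre_digraph" where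
  "orientation n b =
     \<lparr>pverts = {..<n},
      parcs = {(i, j) | i j. (i, j) \<in> vertex_pairs n \<and> b (i, j)} \<union>
              {(j, i) | i j. (i, j) \<in> vertex_pairs n \<and> \<not> b (i, j)}\<rparr>"

text \<open>One independent fair coin for each unordered pair, which is represented by its
  increasing enumeration; \<^const>\<open>False\<close> is only the default value outside the index set.\<close>

definition random_tournament :: "nat \<Rightarrow> nat pair_pre_digraph pmf" where
  "random_tournament n =
     map_pmf (orientation n) (Pi_pmf (vertex_pairs n) False (\<lambda>_. bernoulli_pmf (1 / 2)))"

lemma finite_vertex_pairs: "finite (vertex_pairs n)"
  by (rule finite_subset[of _ "{..<n} \<times> {..<n}"]) (auto simp: vertex_pairs_def)

lemma pair_digraph_orientation: "pair_digraph (orientation n b)"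
proof
  have "parcs (orientation n b) \<subseteq> {..<n} \<times> {..<n}"
    by (auto simp: orientation_def vertex_pairs_def)
  then show "finite (parcs (orientation n b))"
    by (rule finite_subset) simp
qed (auto simp: orientation_def vertex_pairs_def)

lemma orientation_exactly_one_arc:
  assumes "u < n" "v < n" "u \<noteq> v"
  shows "(u, v) \<in> parcs (orientation n b) \<longleftrightarrow> (v, u) \<notin> parcs (orientation n b)"
  using assms by (cases u v rule: linorder_cases) (auto simp: orientation_def vertex_pairs_def)

lemma finite_directed_triangles:
  assumes "finite (parcs D)"
  shows "finite (directed_triangles D)"
  by (rule finite_subset[of _ "Pow (parcs D)"]) (auto simp: directed_triangles_def assms)

lemma nu_t_attained:
  assumes "finite (parcs D)"
  shows "\<exists>T. T \<subseteq> directed_triangles D \<and> disjoint T \<and> nu_t D = card T"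
proof -
  let ?S = "{card T | T. T \<subseteq> directed_triangles D \<and> disjoint T}"
  have "?S \<subseteq> card ` Pow (directed_triangles D)" by auto
  then have "finite ?S"
    by (rule finite_subset) (simp add: finite_directed_triangles assms)
  moreover have "card {} \<in> ?S" by (intro CollectI exI[of _ "{}"]) auto
  ultimately have "Max ?S \<in> ?S" by (intro Max_in) auto
  then show ?thesis unfolding nu_t_def by auto
qed

lemma tau_t_attained:
  assumes "finite (parcs D)"
  shows "\<exists>F. F \<subseteq> parcs D \<and> directed_triangles (D\<lparr>parcs := parcs D - F\<rparr>) = {} \<and> tau_t D = card F"
proof -
  let ?S = "{card F | F. F \<subseteq> parcs D \<and> directed_triangles (D\<lparr>parcs := parcs D - F\<rparr>) = {}}"
  have "?S \<subseteq> card ` Pow (parcs D)" by auto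
  then have "finite ?S"
    by (rule finite_subset) (simp add: assms)
  moreover have "card (parcs D) \<in> ?S"
    by (intro CollectI exI[of _ "parcs D"]) (auto simp: directed_triangles_def)
  ultimately have "Min ?S \<in> ?S" by (intro Min_in) auto
  then show ?thesis unfolding tau_t_def by auto
qed

end

theory Submission
  imports Defs "HOL-Real_Asymp.Real_Asymp"
begin

text \<open>
  Packing. The upper bound on \<open>\<nu>\<close> counts arcs. For the lower bound, identify the vertices (up to a
  bounded number) with the residues modulo \<open>N * 2 ^ R\<close> and pack greedily in \<open>R\<close> rounds: round \<open>k\<close>
  takes every directed triangle \<open>x + y + z = N * 2 ^ (R - k)\<close> whose three arcs are still unused.
  The fate of an arc \<open>xy\<close> up to round \<open>k\<close> depends only on the coins of those pairs whose residues
  \<open>x, y, - x - y\<close> modulo \<open>N * 2 ^ (R - k)\<close> form the same set, and the three arcs of a triangle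
  of the next round have different sets. Hence their fates are independent, and the
  probability that a given ordered pair is an unused arc obeys \<open>q' = q - q ^ 3\<close>, which tends to \<open>0\<close>.
  So the expected packing is nearly perfect, and Markov's inequality concludes.

  Covering. Deleting all forward or all backward arcs gives \<open>\<tau> \<le> n\<^sup>2 / 4\<close>. For the lower bound, let \<open>H\<close> be
  what remains after destroying all directed triangles. By weak (Frieze--Kannan) regularity, \<open>H\<close> is close in cut
  norm to a step function \<open>w\<close> with small triangle density, so by supersaturation \<open>w\<close> exceeds \<open>\<delta>\<close> on little
  more than \<open>n\<^sup>2 / 2\<close> ordered pairs. On the boxes forming this set the tournament has density
  \<open>1 / 2\<close> by Hoeffding's inequality, so \<open>H\<close> has at most \<open>n\<^sup>2 / 4 + o(n\<^sup>2)\<close> arcs.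
\<close>

section \<open>Supersaturation for directed triangles\<close>

definition arcs_on :: "('a \<times> 'a) set \<Rightarrow> 'a set \<Rightarrow> ('a \<times> 'a) set" where
  "arcs_on C V = {(x, y) \<in> C. x \<in> V \<and> y \<in> V \<and> x \<noteq> y}"

text \<open>Each directed triangle is counted three times, once per rotation, so that the count
  compares term by term with a sum of \<open>w x y * w y z * w z x\<close> over all triples.\<close>

definition triangles_on :: "('a \<times> 'a) set \<Rightarrow> 'a set \<Rightarrow> ('a \<times> 'a \<times> 'a) set" where
  "triangles_on C V = {(x, y, z). x \<in> V \<and> y \<in> V \<and> z \<in> V \<and> x \<noteq> y \<and> y \<noteq> z \<and> z \<noteq> x \<and>
     (x, y) \<in> C \<and> (y, z) \<in> C \<and> (z, x) \<in> C}"

lemma finite_arcs_on: "finite V \<Longrightarrow> finite (arcs_on C V)"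
  by (rule finite_subset[of _ "V \<times> V"]) (auto simp: arcs_on_def)

lemma finite_triangles_on: "finite V \<Longrightarrow> finite (triangles_on C V)"
  by (rule finite_subset[of _ "V \<times> V \<times> V"]) (auto simp: triangles_on_def)

lemma card_off_diagonal:
  assumes "finite V"
  shows "card {(x, y) \<in> V \<times> V. x \<noteq> y} = card V * (card V - 1)"
proof -
  have "{(x, y) \<in> V \<times> V. x \<noteq> y} = (SIGMA x:V. V - {x})" by auto
  then show ?thesis using assms by simp
qed

lemma card_arcs_on_le:
  assumes "finite V"
  shows "card (arcs_on C V) \<le> card V * (card V - 1)"
  unfolding card_off_diagonal[OF assms, symmetric]
  by (rule card_mono) (auto simp: arcs_on_def assms intro: finite_subset[of _ "V \<times> V"])

text \<open>Both \<open>xy\<close> and \<open>yx\<close> may lie in \<open>C\<close>. If this never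
  happens, the arcs and their converses are disjoint subsets of \<open>V \<times> V\<close>.
  Otherwise delete such \<open>x\<close> and \<open>y\<close>: this loses the two arcs between them
  and at most two arcs at each other vertex, and \<open>m^2 + 4 * m + 4 = (m + 2)^2\<close>.
  Equality holds for the balanced complete bipartite digraph with all arcs in both
  directions.\<close>

lemma card_arcs_on_triangle_free:
  assumes "finite V" "triangles_on C V = {}"
  shows "2 * card (arcs_on C V) \<le> card V ^ 2"
  using assms
proof (induction "card V" arbitrary: V rule: less_induct)
  case less
  note fin = \<open>finite V\<close>
  show ?case
  proof (cases "\<exists>x\<in>V. \<exists>y\<in>V. x \<noteq> y \<and> (x, y) \<in> C \<and> (y, x) \<in> C")
    case True
    then obtain x y where xy: "x \<in> V" "y \<in> V" "x \<noteq> y" "(x, y) \<in> C" "(y, x) \<in> C" by blast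
    define V' where "V' = V - {x, y}"
    define B where "B z = {(x, z), (z, x), (y, z), (z, y)} \<inter> C" for z
    have cardV: "card V = card V' + 2"
      using xy fin card_Diff_subset[of "{x, y}" V] card_mono[of V "{x, y}"]
      by (simp add: V'_def)
    have "triangles_on C V' = {}"
      using less.prems(2) by (auto simp: triangles_on_def V'_def)
    then have IH: "2 * card (arcs_on C V') \<le> card V' ^ 2"
      using less.hyps[of V'] cardV fin by (simp add: V'_def)
    have B2: "card (B z) \<le> 2" if "z \<in> V'" for z
    proof -
      have nt: "(u, v, w) \<notin> triangles_on C V" for u v w using less.prems(2) by simp
      have "\<not> ((y, z) \<in> C \<and> (z, x) \<in> C)" "\<not> ((x, z) \<in> C \<and> (z, y) \<in> C)"
        using nt[of x y z] nt[of y x z] xy that by (auto simp: triangles_on_def V'_def)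
      \<comment> \<open>At most one of \<open>yz\<close>, \<open>zx\<close> and at most one of
        \<open>xz\<close>, \<open>zy\<close> lies in \<open>C\<close>; each conditional names the
        only arc of its pair that can occur.\<close>
      then have "B z \<subseteq> {if (y, z) \<in> C then (y, z) else (z, x), if (x, z) \<in> C then (x, z) else (z, y)}"
        by (auto simp: B_def)
      then show ?thesis
        by (rule order.trans[OF card_mono[rotated]]) (auto intro: card_insert_le_m1)
    qed
    have "arcs_on C V \<subseteq> arcs_on C V' \<union> {(x, y), (y, x)} \<union> (\<Union>z\<in>V'. B z)"
      by (auto simp: arcs_on_def V'_def B_def)
    then have "card (arcs_on C V) \<le> card (arcs_on C V' \<union> {(x, y), (y, x)} \<union> (\<Union>z\<in>V'. B z))"
      by (rule card_mono[rotated]) (auto simp: finite_arcs_on fin V'_def B_def)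
    also have "\<dots> \<le> card (arcs_on C V') + card {(x, y), (y, x)} + card (\<Union>z\<in>V'. B z)"
      by (meson add_mono card_Un_le le_refl order_trans)
    also have "card (\<Union>z\<in>V'. B z) \<le> (\<Sum>z\<in>V'. card (B z))"
      using fin by (intro card_UN_le) (simp add: V'_def)
    also have "\<dots> \<le> (\<Sum>z\<in>V'. 2)" using B2 by (rule sum_mono)
    finally have "card (arcs_on C V) \<le> card (arcs_on C V') + 2 + 2 * card V'"
      using xy by simp
    then show ?thesis using IH unfolding cardV by (simp add: power2_eq_square algebra_simps)
  next
    case False
    then have "arcs_on C V \<inter> (arcs_on C V)\<inverse> = {}" by (auto simp: arcs_on_def)
    then have "card (arcs_on C V \<union> (arcs_on C V)\<inverse>) = 2 * card (arcs_on C V)"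
      using fin by (subst card_Un_disjoint) (auto simp: finite_arcs_on)
    moreover have "card (arcs_on C V \<union> (arcs_on C V)\<inverse>) \<le> card (V \<times> V)"
      using fin by (intro card_mono) (auto simp: arcs_on_def)
    ultimately show ?thesis by (simp add: card_cartesian_product power2_eq_square)
  qed
qed

text \<open>Double counting: each \<open>a\<close> survives the deletion of exactly the
  \<open>card V - r\<close> vertices outside \<open>S a\<close>. It serves arcs with
  \<open>r = 2\<close> and triangles with \<open>r = 3\<close>.\<close>

lemma sum_card_vertex_deleted:
  assumes "finite V" "finite A" "\<And>a. a \<in> A \<Longrightarrow> S a \<subseteq> V" "\<And>a. a \<in> A \<Longrightarrow> card (S a) = r"
  shows "(\<Sum>v\<in>V. card {a \<in> A. v \<notin> S a}) = (card V - r) * card A"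
proof -
  have "(\<Sum>v\<in>V. card {a \<in> A. v \<notin> S a}) = (\<Sum>v\<in>V. \<Sum>a\<in>A. if v \<notin> S a then 1 else 0)"
    using assms(2) by (simp add: sum.If_cases Int_def)
  also have "\<dots> = (\<Sum>a\<in>A. \<Sum>v\<in>V. if v \<notin> S a then 1 else 0)" by (rule sum.swap)
  also have "\<dots> = (\<Sum>a\<in>A. card (V - S a))"
    using assms(1) by (intro sum.cong) (auto simp: sum.If_cases intro!: arg_cong[where f = card])
  also have "\<dots> = (\<Sum>a\<in>A. card V - r)"
    using assms by (intro sum.cong) (auto simp: card_Diff_subset finite_subset[OF _ assms(1)])
  finally show ?thesis by simp
qed

text \<open>Averaging over the vertex-deleted subsets gives an induction on \<open>card V\<close>:
  of \<open>n + 1\<close> deletions an arc survives \<open>n - 1\<close> and a triangle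
  \<open>n - 2\<close>, and both terms on the right are normalised so that the step loses nothing.
  At \<open>card V = k\<close> either the triangle-free bound applies, or one triangle already makes
  the last term exceed the trivial bound \<open>k^2\<close>.\<close>

lemma supersaturation:
  assumes "finite V" "k \<ge> 3" "card V \<ge> k"
  shows "real (card (arcs_on C V)) \<le> real k / (2 * (real k - 1)) * (real (card V) * (real (card V) - 1))
           + real k ^ 3 * real (card (triangles_on C V)) / (real (card V) - 2)"
  using \<open>k \<le> card V\<close> \<open>finite V\<close>
proof (induction "card V" arbitrary: V rule: nat_induct_at_least)
  case base
  have eq: "real k / (2 * (real k - 1)) * (real k * (real k - 1)) = real k ^ 2 / 2"
    using assms(2) by (simp add: field_simps power2_eq_square)
  show ?case
  proof (cases "triangles_on C V = {}")
    case True
    then have "2 * card (arcs_on C V) \<le> k ^ 2"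
      using card_arcs_on_triangle_free base by metis
    then have "2 * real (card (arcs_on C V)) \<le> real k ^ 2"
      by (metis of_nat_le_iff of_nat_mult of_nat_numeral of_nat_power)
    then show ?thesis unfolding base(1)[symmetric] eq using True by simp
  next
    case False
    then have ge1: "card (triangles_on C V) \<ge> 1"
      using finite_triangles_on[OF base(2)] by (simp add: Suc_le_eq card_gt_0_iff)
    have "card (arcs_on C V) \<le> k * k"
      using card_arcs_on_le[OF base(2), of C] base(1) by (meson diff_le_self le_trans mult_le_mono2)
    then have "real (card (arcs_on C V)) \<le> real k * real k"
      by (metis of_nat_le_iff of_nat_mult)
    then have "real (card (arcs_on C V)) \<le> real k ^ 3 / real k"
      using assms(2) by (simp add: power3_eq_cube)
    also have "\<dots> \<le> real k ^ 3 * 1 / (real k - 2)"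
      using assms(2) by (simp add: frac_le)
    also have "\<dots> \<le> real k ^ 3 * real (card (triangles_on C V)) / (real k - 2)"
      using ge1 assms(2) by (intro divide_right_mono mult_left_mono) auto
    finally show ?thesis unfolding base(1)[symmetric] eq by (simp add: add_increasing)
  qed
next
  case (Suc n)
  let ?a = "real k / (2 * (real k - 1))"
  have n: "n \<ge> 3" "card V = Suc n" "finite V" using Suc assms(2) by auto
  define S where "S = (\<lambda>(x::'a, y). {x, y})"
  define S' where "S' = (\<lambda>(x::'a, y, z). {x, y, z})"
  have "arcs_on C (V - {v}) = {a \<in> arcs_on C V. v \<notin> S a}" for v
    by (auto simp: arcs_on_def S_def)
  moreover have "(\<Sum>v\<in>V. card {a \<in> arcs_on C V. v \<notin> S a}) = (card V - 2) * card (arcs_on C V)"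
    by (rule sum_card_vertex_deleted[OF n(3) finite_arcs_on[OF n(3)]]) (auto simp: arcs_on_def S_def)
  ultimately have e: "(\<Sum>v\<in>V. card (arcs_on C (V - {v}))) = (n - 1) * card (arcs_on C V)"
    using n by simp
  have "triangles_on C (V - {v}) = {a \<in> triangles_on C V. v \<notin> S' a}" for v
    by (auto simp: triangles_on_def S'_def)
  moreover have "(\<Sum>v\<in>V. card {a \<in> triangles_on C V. v \<notin> S' a}) = (card V - 3) * card (triangles_on C V)"
    by (rule sum_card_vertex_deleted[OF n(3) finite_triangles_on[OF n(3)]]) (auto simp: triangles_on_def S'_def)
  ultimately have t: "(\<Sum>v\<in>V. card (triangles_on C (V - {v}))) = (n - 2) * card (triangles_on C V)"
    using n by simp
  have IH: "real (card (arcs_on C (V - {v}))) \<le> ?a * (real n * (real n - 1))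
      + real k ^ 3 * real (card (triangles_on C (V - {v}))) / (real n - 2)" if "v \<in> V" for v
  proof -
    have "n = card (V - {v})" "finite (V - {v})" using n that by auto
    from Suc(2)[OF this] this(1) show ?thesis by metis
  qed
  have "(real n - 1) * real (card (arcs_on C V)) = (\<Sum>v\<in>V. real (card (arcs_on C (V - {v}))))"
    using e n by (simp flip: of_nat_sum)
  also have "\<dots> \<le> (\<Sum>v\<in>V. ?a * (real n * (real n - 1))
      + real k ^ 3 * real (card (triangles_on C (V - {v}))) / (real n - 2))"
    using IH by (rule sum_mono)
  also have "\<dots> = (real n + 1) * ?a * (real n * (real n - 1))
      + real k ^ 3 * (\<Sum>v\<in>V. real (card (triangles_on C (V - {v})))) / (real n - 2)"
    using n by (simp add: sum.distrib sum_distrib_left sum_divide_distrib algebra_simps)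
  also have "(\<Sum>v\<in>V. real (card (triangles_on C (V - {v})))) = (real n - 2) * real (card (triangles_on C V))"
    using t n by (simp flip: of_nat_sum)
  also have "(real n + 1) * ?a * (real n * (real n - 1)) +
      real k ^ 3 * ((real n - 2) * real (card (triangles_on C V))) / (real n - 2)
      = (real n - 1) * (?a * ((real n + 1) * real n) + real k ^ 3 * real (card (triangles_on C V)) / (real n - 1))"
    using n(1) by (simp add: field_simps)
  finally have "real (card (arcs_on C V)) \<le>
      ?a * ((real n + 1) * real n) + real k ^ 3 * real (card (triangles_on C V)) / (real n - 1)"
    using n(1) by simp
  then show ?case by (simp add: n(2) add.commute)
qed

section \<open>Weak regularity\<close>

text \<open>A partition is given by a labelling \<open>p\<close> whose fibres are the classes, so
  that refining it means adding bits to the labels.\<close>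

definition part_class :: "'a set \<Rightarrow> ('a \<Rightarrow> 'l) \<Rightarrow> 'a \<Rightarrow> 'a set" where
  "part_class V p x = {u \<in> V. p u = p x}"

definition class_kernel :: "'a set \<Rightarrow> ('a \<Rightarrow> 'l) \<Rightarrow> 'a \<Rightarrow> 'a \<Rightarrow> real" where
  "class_kernel V p x u = (if p u = p x then 1 / real (card (part_class V p x)) else 0)"

text \<open>The conditional expectation of \<open>h\<close> on the boxes of the partition. The
  product form of the kernel lets the two variables be averaged one at a time.\<close>

definition class_average :: "'a set \<Rightarrow> ('a \<Rightarrow> 'l) \<Rightarrow> ('a \<Rightarrow> 'a \<Rightarrow> real) \<Rightarrow> 'a \<Rightarrow> 'a \<Rightarrow> real" where
  "class_average V p h x y = (\<Sum>u\<in>V. \<Sum>v\<in>V. class_kernel V p x u * class_kernel V p y v * h u v)"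

definition class_invariant :: "'a set \<Rightarrow> ('a \<Rightarrow> 'l) \<Rightarrow> ('a \<Rightarrow> 'a \<Rightarrow> real) \<Rightarrow> bool" where
  "class_invariant V p g \<longleftrightarrow>
     (\<forall>x\<in>V. \<forall>x'\<in>V. \<forall>y\<in>V. \<forall>y'\<in>V. p x = p x' \<longrightarrow> p y = p y' \<longrightarrow> g x y = g x' y')"

lemma class_kernel_nonneg: "class_kernel V p x u \<ge> 0"
  by (simp add: class_kernel_def)

lemma class_kernel_commute: "class_kernel V p x u = class_kernel V p u x"
  by (auto simp: class_kernel_def part_class_def)

lemma sum_class_kernel:
  assumes "finite V" "x \<in> V"
  shows "(\<Sum>u\<in>V. class_kernel V p x u) = 1"
proof -
  have "(\<Sum>u\<in>V. class_kernel V p x u) = (\<Sum>u\<in>part_class V p x. 1 / real (card (part_class V p x)))"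
    unfolding class_kernel_def using assms(1)
    by (subst sum.inter_filter[symmetric]) (auto simp: part_class_def)
  also have "\<dots> = 1"
    using assms by (auto simp: part_class_def)
  finally show ?thesis .
qed

text \<open>Averaging over classes is self-adjoint, because the kernel is symmetric, and it fixes
  \<open>g\<close>, which is constant on classes.\<close>

lemma sum_class_kernel_mult:
  assumes "finite V" "\<And>x x'. x \<in> V \<Longrightarrow> x' \<in> V \<Longrightarrow> p x = p x' \<Longrightarrow> g x = (g x' :: real)"
  shows "(\<Sum>x\<in>V. (\<Sum>u\<in>V. class_kernel V p x u * f u) * g x) = (\<Sum>u\<in>V. f u * g u)"
proof -
  have "(\<Sum>x\<in>V. (\<Sum>u\<in>V. class_kernel V p x u * f u) * g x)
      = (\<Sum>u\<in>V. \<Sum>x\<in>V. class_kernel V p x u * f u * g x)"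
    by (subst sum.swap) (simp add: sum_distrib_right)
  also have "\<dots> = (\<Sum>u\<in>V. \<Sum>x\<in>V. class_kernel V p u x * (f u * g u))"
  proof (intro sum.cong refl)
    fix u x assume "u \<in> V" "x \<in> V"
    then show "class_kernel V p x u * f u * g x = class_kernel V p u x * (f u * g u)"
      using assms(2)[of x u] class_kernel_commute[of V p x u]
      by (cases "p u = p x") (auto simp: class_kernel_def)
  qed
  also have "\<dots> = (\<Sum>u\<in>V. f u * g u)"
    using assms(1) by (intro sum.cong refl) (simp add: sum_class_kernel flip: sum_distrib_right)
  finally show ?thesis .
qed

text \<open>The one-variable identity is applied in each variable. Thus \<open>class_average\<close>
  is the orthogonal projection onto the functions constant on boxes.\<close>

lemma sum_class_average_mult:
  assumes "finite V" "class_invariant V p g"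
  shows "(\<Sum>x\<in>V. \<Sum>y\<in>V. class_average V p h x y * g x y) = (\<Sum>x\<in>V. \<Sum>y\<in>V. h x y * g x y)"
proof -
  let ?K = "class_kernel V p"
  have inv: "g x y = g x' y'" if "x \<in> V" "x' \<in> V" "y \<in> V" "y' \<in> V" "p x = p x'" "p y = p y'" for x x' y y'
    using assms(2) that unfolding class_invariant_def by blast
  have avg: "class_average V p h x y = (\<Sum>u\<in>V. ?K x u * (\<Sum>v\<in>V. ?K y v * h u v))" for x y
    by (simp add: class_average_def sum_distrib_left mult_ac)
  have "(\<Sum>x\<in>V. \<Sum>y\<in>V. class_average V p h x y * g x y)
      = (\<Sum>y\<in>V. \<Sum>x\<in>V. (\<Sum>u\<in>V. ?K x u * (\<Sum>v\<in>V. ?K y v * h u v)) * g x y)"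
    unfolding avg by (rule sum.swap)
  also have "\<dots> = (\<Sum>y\<in>V. \<Sum>u\<in>V. (\<Sum>v\<in>V. ?K y v * h u v) * g u y)"
    by (rule sum.cong[OF refl], rule sum_class_kernel_mult[OF assms(1)]) (blast intro: inv)
  also have "\<dots> = (\<Sum>u\<in>V. \<Sum>y\<in>V. (\<Sum>v\<in>V. ?K y v * h u v) * g u y)"
    by (rule sum.swap)
  also have "\<dots> = (\<Sum>u\<in>V. \<Sum>y\<in>V. h u y * g u y)"
    by (rule sum.cong[OF refl], rule sum_class_kernel_mult[OF assms(1)]) (blast intro: inv)
  finally show ?thesis .
qed

lemma class_invariant_average: "class_invariant V p (class_average V p h)"
proof -
  have K: "class_kernel V p x = class_kernel V p x'" if "p x = p x'" for x x'
    by (simp add: fun_eq_iff class_kernel_def part_class_def that)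
  show ?thesis
    unfolding class_invariant_def
  proof (intro ballI impI)
    fix x x' y y' assume "p x = p x'" "p y = p y'"
    then show "class_average V p h x y = class_average V p h x' y'"
      by (simp only: class_average_def K[of x x'] K[of y y'])
  qed
qed

lemma class_invariant_refine:
  assumes "class_invariant V p g" "\<And>x y. p' x = p' y \<Longrightarrow> p x = p y"
  shows "class_invariant V p' g"
  unfolding class_invariant_def
proof (intro ballI impI)
  fix x x' y y' assume "x \<in> V" "x' \<in> V" "y \<in> V" "y' \<in> V" "p' x = p' x'" "p' y = p' y'"
  then show "g x y = g x' y'"
    using assms(1) assms(2)[of x x'] assms(2)[of y y'] unfolding class_invariant_def by blast
qed

lemma class_average_bounds:
  assumes "finite V" "\<And>x y. x \<in> V \<Longrightarrow> y \<in> V \<Longrightarrow> 0 \<le> h x y \<and> h x y \<le> 1" "x \<in> V" "y \<in> V"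
  shows "0 \<le> class_average V p h x y" "class_average V p h x y \<le> 1"
proof -
  show "0 \<le> class_average V p h x y"
    unfolding class_average_def using assms(2)
    by (intro sum_nonneg mult_nonneg_nonneg) (auto simp: class_kernel_nonneg)
  have "class_average V p h x y \<le> (\<Sum>u\<in>V. \<Sum>v\<in>V. class_kernel V p x u * class_kernel V p y v * 1)"
    unfolding class_average_def using assms(2)
    by (intro sum_mono mult_left_mono mult_nonneg_nonneg) (auto simp: class_kernel_nonneg)
  also have "\<dots> = 1"
    using assms by (simp add: sum_class_kernel flip: sum_distrib_left)
  finally show "class_average V p h x y \<le> 1" .
qed

text \<open>Let \<open>w\<close> and \<open>w'\<close> be the averages over \<open>p\<close> and
  \<open>p'\<close>. Testing against \<open>g\<close> does not distinguish \<open>h\<close> from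
  \<open>w'\<close>, so Cauchy-Schwarz bounds the left side by the squared norm of
  \<open>w' - w\<close> times \<open>card V ^ 2\<close>. By Pythagoras that norm is the energy
  difference, as \<open>w\<close> is itself constant on the boxes of \<open>p'\<close>.\<close>

lemma energy_increment:
  assumes "finite V" "\<And>x y. p' x = p' y \<Longrightarrow> p x = p y" "class_invariant V p' g"
    "\<And>x y. x \<in> V \<Longrightarrow> y \<in> V \<Longrightarrow> \<bar>g x y\<bar> \<le> 1"
  shows "(\<Sum>x\<in>V. \<Sum>y\<in>V. (h x y - class_average V p h x y) * g x y)\<^sup>2
    \<le> ((\<Sum>x\<in>V. \<Sum>y\<in>V. (class_average V p' h x y)\<^sup>2) - (\<Sum>x\<in>V. \<Sum>y\<in>V. (class_average V p h x y)\<^sup>2))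
        * real (card V) ^ 2"
proof -
  let ?w = "class_average V p h" and ?w' = "class_average V p' h"
  have inv: "class_invariant V p ?w" "class_invariant V p' ?w"
    using class_invariant_average class_invariant_refine[OF class_invariant_average assms(2)] .
  have "(\<Sum>x\<in>V. \<Sum>y\<in>V. h x y * g x y) = (\<Sum>x\<in>V. \<Sum>y\<in>V. ?w' x y * g x y)"
    using assms by (simp add: sum_class_average_mult)
  then have "(\<Sum>x\<in>V. \<Sum>y\<in>V. (h x y - ?w x y) * g x y) = (\<Sum>x\<in>V. \<Sum>y\<in>V. (?w' x y - ?w x y) * g x y)"
    by (simp add: left_diff_distrib sum_subtractf)
  also have "\<dots> = (\<Sum>e\<in>V \<times> V. (case e of (x, y) \<Rightarrow> ?w' x y - ?w x y) * (case e of (x, y) \<Rightarrow> g x y))"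
    by (simp add: sum.cartesian_product split_def)
  also have "\<dots>\<^sup>2 \<le> (\<Sum>e\<in>V \<times> V. (case e of (x, y) \<Rightarrow> ?w' x y - ?w x y)\<^sup>2) * (\<Sum>e\<in>V \<times> V. (case e of (x, y) \<Rightarrow> g x y)\<^sup>2)"
    by (rule Cauchy_Schwarz_ineq_sum)
  also have "\<dots> \<le> (\<Sum>e\<in>V \<times> V. (case e of (x, y) \<Rightarrow> ?w' x y - ?w x y)\<^sup>2) * (\<Sum>e\<in>V \<times> V. 1)"
    using assms(4) by (intro mult_left_mono sum_mono sum_nonneg) (auto simp: abs_square_le_1)
  also have "(\<Sum>e\<in>V \<times> V. (1::real)) = real (card V) ^ 2"
    by (simp add: card_cartesian_product power2_eq_square)
  also have "(\<Sum>e\<in>V \<times> V. (case e of (x, y) \<Rightarrow> ?w' x y - ?w x y)\<^sup>2) = (\<Sum>x\<in>V. \<Sum>y\<in>V. (?w' x y - ?w x y)\<^sup>2)"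
    by (simp add: sum.cartesian_product split_def)
  also have "\<dots> = (\<Sum>x\<in>V. \<Sum>y\<in>V. (?w' x y)\<^sup>2) - 2 * (\<Sum>x\<in>V. \<Sum>y\<in>V. ?w' x y * ?w x y) + (\<Sum>x\<in>V. \<Sum>y\<in>V. (?w x y)\<^sup>2)"
    by (simp add: power2_diff sum.distrib sum_subtractf sum_distrib_left mult.assoc)
  also have "(\<Sum>x\<in>V. \<Sum>y\<in>V. ?w' x y * ?w x y) = (\<Sum>x\<in>V. \<Sum>y\<in>V. h x y * ?w x y)"
    using assms(1) inv(2) by (rule sum_class_average_mult)
  also have "\<dots> = (\<Sum>x\<in>V. \<Sum>y\<in>V. (?w x y)\<^sup>2)"
    using sum_class_average_mult[OF assms(1) inv(1), of h] by (simp add: power2_eq_square)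
  finally show ?thesis by (simp add: algebra_simps)
qed

text \<open>Every round refines the partition by the two sides of a violated cut, which costs two bits.\<close>

lemma weak_regularity:
  fixes h :: "'a \<Rightarrow> 'a \<Rightarrow> real"
  assumes "finite V" "V \<noteq> {}" "\<epsilon> > 0"
    "\<And>x y. x \<in> V \<Longrightarrow> y \<in> V \<Longrightarrow> 0 \<le> h x y \<and> h x y \<le> 1"
  shows "\<exists>t. \<exists>p :: 'a \<Rightarrow> bool list. real t \<le> 1 / \<epsilon>\<^sup>2 \<and> (\<forall>x. length (p x) = 2 * t) \<and>
    (\<forall>S T. S \<subseteq> V \<longrightarrow> T \<subseteq> V \<longrightarrow>
      \<bar>\<Sum>x\<in>S. \<Sum>y\<in>T. h x y - class_average V p h x y\<bar> \<le> \<epsilon> * real (card V) ^ 2)"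
proof (rule ccontr)
  assume neg: "\<not> ?thesis"
  let ?n = "real (card V)"
  let ?E = "\<lambda>p :: 'a \<Rightarrow> bool list. \<Sum>x\<in>V. \<Sum>y\<in>V. (class_average V p h x y)\<^sup>2"
  have n: "?n > 0" using assms by (simp add: card_gt_0_iff)
  have E_le: "?E p \<le> ?n ^ 2" for p
  proof -
    have "?E p \<le> (\<Sum>x\<in>V. \<Sum>y\<in>V. 1)"
      using class_average_bounds[of V h, OF assms(1,4)]
      by (intro sum_mono power_le_one) auto
    then show ?thesis by (simp add: power2_eq_square)
  qed
  \<comment> \<open>While every partition has a violated cut, each round raises the energy by at
    least \<open>\<epsilon>^2 * n^2\<close>. The range of \<open>t\<close> extends beyond
    \<open>1 / \<epsilon>^2\<close>, where the energy would exceed its bound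
    \<open>n^2\<close>.\<close>
  have step: "\<exists>p. (\<forall>x. length (p x) = 2 * t) \<and> real t * \<epsilon>\<^sup>2 * ?n ^ 2 \<le> ?E p"
    if "real t \<le> 1 / \<epsilon>\<^sup>2 + 1" for t
    using that
  proof (induction t)
    case 0
    show ?case by (intro exI[of _ "\<lambda>_. []"]) (simp add: sum_nonneg)
  next
    case (Suc t)
    then obtain p where p: "\<And>x. length (p x) = 2 * t" "real t * \<epsilon>\<^sup>2 * ?n ^ 2 \<le> ?E p" by auto
    have "real t \<le> 1 / \<epsilon>\<^sup>2" using Suc.prems by simp
    then have "\<not> (\<forall>S T. S \<subseteq> V \<longrightarrow> T \<subseteq> V \<longrightarrow>
        \<bar>\<Sum>x\<in>S. \<Sum>y\<in>T. h x y - class_average V p h x y\<bar> \<le> \<epsilon> * ?n ^ 2)"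
      using neg p(1) by blast
    then obtain S T where ST: "S \<subseteq> V" "T \<subseteq> V"
      "\<bar>\<Sum>x\<in>S. \<Sum>y\<in>T. h x y - class_average V p h x y\<bar> > \<epsilon> * ?n ^ 2"
      unfolding not_all not_imp not_le by blast
    define p' where "p' x = (x \<in> S) # (x \<in> T) # p x" for x
    define g :: "'a \<Rightarrow> 'a \<Rightarrow> real" where "g x y = of_bool (x \<in> S) * of_bool (y \<in> T)" for x y
    have "(\<Sum>x\<in>V. \<Sum>y\<in>V. (h x y - class_average V p h x y) * g x y)
        = (\<Sum>x\<in>V. if x \<in> S then (\<Sum>y\<in>V. if y \<in> T then h x y - class_average V p h x y else 0) else 0)"
      by (intro sum.cong refl) (auto simp: g_def intro!: sum.cong)
    also have "\<dots> = (\<Sum>x\<in>S. \<Sum>y\<in>T. h x y - class_average V p h x y)"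
      using assms(1) ST by (simp add: Int_absorb1 flip: sum.inter_restrict)
    finally have eq: "(\<Sum>x\<in>V. \<Sum>y\<in>V. (h x y - class_average V p h x y) * g x y)
      = (\<Sum>x\<in>S. \<Sum>y\<in>T. h x y - class_average V p h x y)" .
    have "(\<epsilon> * ?n\<^sup>2)\<^sup>2 \<le> (\<Sum>x\<in>V. \<Sum>y\<in>V. (h x y - class_average V p h x y) * g x y)\<^sup>2"
      unfolding eq using ST(3) assms(3) by (subst abs_le_square_iff[symmetric]) auto
    also have "\<dots> \<le> (?E p' - ?E p) * ?n ^ 2"
      using assms(1) by (intro energy_increment) (auto simp: p'_def g_def class_invariant_def)
    finally have "(\<epsilon>\<^sup>2 * ?n\<^sup>2) * ?n\<^sup>2 \<le> (?E p' - ?E p) * ?n\<^sup>2"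
      by (simp add: power2_eq_square algebra_simps)
    then have "\<epsilon>\<^sup>2 * ?n\<^sup>2 \<le> ?E p' - ?E p" using n by simp
    then have "real (Suc t) * \<epsilon>\<^sup>2 * ?n ^ 2 \<le> ?E p'"
      using p(2) by (simp add: algebra_simps)
    moreover have "length (p' x) = 2 * Suc t" for x by (simp add: p'_def p(1))
    ultimately show ?case by blast
  qed
  define t where "t = nat (floor (1 / \<epsilon>\<^sup>2)) + 1"
  have t: "real t \<le> 1 / \<epsilon>\<^sup>2 + 1" "real t > 1 / \<epsilon>\<^sup>2"
    unfolding t_def by (simp_all add: of_nat_nat) linarith+
  obtain p where "real t * \<epsilon>\<^sup>2 * ?n ^ 2 \<le> ?E p" using step[OF t(1)] by blast
  also have "\<dots> \<le> ?n ^ 2" by (rule E_le)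
  finally have "real t * \<epsilon>\<^sup>2 \<le> 1" using n by simp
  then show False using t(2) assms(3) by (simp add: field_simps)
qed

section \<open>Counting triangles through the cut norm\<close>

text \<open>The sum is linear in \<open>a\<close> and in \<open>b\<close> separately, so each may be
  replaced by the indicator of the places where its coefficient is positive. This yields first
  \<open>S\<close>, then \<open>T\<close>.\<close>

lemma cut_norm_fractional:
  fixes D :: "'a \<Rightarrow> 'b \<Rightarrow> real"
  assumes "finite V" "finite W"
    "\<And>S T. S \<subseteq> V \<Longrightarrow> T \<subseteq> W \<Longrightarrow> (\<Sum>x\<in>S. \<Sum>y\<in>T. D x y) \<le> c"
    "\<And>x. x \<in> V \<Longrightarrow> 0 \<le> a x \<and> a x \<le> 1" "\<And>y. y \<in> W \<Longrightarrow> 0 \<le> b y \<and> b y \<le> 1"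
  shows "(\<Sum>x\<in>V. \<Sum>y\<in>W. D x y * a x * b y) \<le> c"
proof -
  have pos_part: "(\<Sum>x\<in>U. f x * a x) \<le> (\<Sum>x | x \<in> U \<and> f x > 0. f x)"
    if "finite U" "\<And>x. x \<in> U \<Longrightarrow> 0 \<le> a x \<and> a x \<le> 1" for U and f a :: "'c \<Rightarrow> real"
  proof -
    have "(\<Sum>x\<in>U. f x * a x) \<le> (\<Sum>x\<in>U. if f x > 0 then f x else 0)"
      using that(2) by (intro sum_mono) (auto simp: mult_left_le mult_le_0_iff)
    then show ?thesis by (simp add: sum.inter_filter that(1))
  qed
  define S where "S = {x \<in> V. (\<Sum>y\<in>W. D x y * b y) > 0}"
  define T where "T = {y \<in> W. (\<Sum>x\<in>S. D x y) > 0}"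
  have "(\<Sum>x\<in>V. \<Sum>y\<in>W. D x y * a x * b y) = (\<Sum>x\<in>V. (\<Sum>y\<in>W. D x y * b y) * a x)"
    by (simp add: sum_distrib_left mult_ac)
  also have "\<dots> \<le> (\<Sum>x\<in>S. \<Sum>y\<in>W. D x y * b y)"
    unfolding S_def using assms by (intro pos_part) auto
  also have "\<dots> = (\<Sum>y\<in>W. (\<Sum>x\<in>S. D x y) * b y)"
    by (subst sum.swap) (simp add: sum_distrib_right)
  also have "\<dots> \<le> (\<Sum>y\<in>T. \<Sum>x\<in>S. D x y)"
    unfolding T_def using assms by (intro pos_part) auto
  also have "\<dots> = (\<Sum>x\<in>S. \<Sum>y\<in>T. D x y)" by (rule sum.swap)
  also have "\<dots> \<le> c" by (rule assms(3)) (auto simp: S_def T_def)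
  finally show ?thesis .
qed

text \<open>Replace \<open>w\<close> by \<open>h\<close> one factor at a time. Each of the three
  resulting terms contains one difference \<open>w - h\<close>; with the opposite vertex fixed, the
  other two factors depend on one endpoint each, as in a fractional cut.\<close>

lemma triangle_counting:
  fixes h w :: "'a \<Rightarrow> 'a \<Rightarrow> real"
  assumes "finite V"
    "\<And>S T. S \<subseteq> V \<Longrightarrow> T \<subseteq> V \<Longrightarrow> (\<Sum>x\<in>S. \<Sum>y\<in>T. w x y - h x y) \<le> c"
    "\<And>x y. x \<in> V \<Longrightarrow> y \<in> V \<Longrightarrow> 0 \<le> h x y \<and> h x y \<le> 1"
    "\<And>x y. x \<in> V \<Longrightarrow> y \<in> V \<Longrightarrow> 0 \<le> w x y \<and> w x y \<le> 1"
  shows "(\<Sum>x\<in>V. \<Sum>y\<in>V. \<Sum>z\<in>V. w x y * w y z * w z x)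
       \<le> (\<Sum>x\<in>V. \<Sum>y\<in>V. \<Sum>z\<in>V. h x y * h y z * h z x) + 3 * c * real (card V)"
proof -
  let ?D = "\<lambda>x y. w x y - h x y"
  have bound: "(\<Sum>z\<in>V. \<Sum>x\<in>V. \<Sum>y\<in>V. ?D x y * a z x * b z y) \<le> c * real (card V)"
    if "\<And>x z. x \<in> V \<Longrightarrow> z \<in> V \<Longrightarrow> 0 \<le> a z x \<and> a z x \<le> 1"
       "\<And>x z. x \<in> V \<Longrightarrow> z \<in> V \<Longrightarrow> 0 \<le> b z x \<and> b z x \<le> 1" for a b
  proof -
    have "(\<Sum>z\<in>V. \<Sum>x\<in>V. \<Sum>y\<in>V. ?D x y * a z x * b z y) \<le> (\<Sum>z\<in>V. c)"
      using assms that by (intro sum_mono cut_norm_fractional) auto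
    then show ?thesis by (simp add: mult.commute)
  qed
  have rot: "(\<Sum>x\<in>V. \<Sum>y\<in>V. \<Sum>z\<in>V. F x y z) = (\<Sum>z\<in>V. \<Sum>x\<in>V. \<Sum>y\<in>V. F x y z)"
    for F :: "'a \<Rightarrow> 'a \<Rightarrow> 'a \<Rightarrow> real"
  proof -
    have "(\<Sum>x\<in>V. \<Sum>y\<in>V. \<Sum>z\<in>V. F x y z) = (\<Sum>x\<in>V. \<Sum>z\<in>V. \<Sum>y\<in>V. F x y z)"
      by (intro sum.cong refl sum.swap)
    also have "\<dots> = (\<Sum>z\<in>V. \<Sum>x\<in>V. \<Sum>y\<in>V. F x y z)" by (rule sum.swap)
    finally show ?thesis .
  qed
  have "(\<Sum>x\<in>V. \<Sum>y\<in>V. \<Sum>z\<in>V. w x y * w y z * w z x) - (\<Sum>x\<in>V. \<Sum>y\<in>V. \<Sum>z\<in>V. h x y * h y z * h z x)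
     = (\<Sum>x\<in>V. \<Sum>y\<in>V. \<Sum>z\<in>V. ?D x y * w z x * w y z) + (\<Sum>x\<in>V. \<Sum>y\<in>V. \<Sum>z\<in>V. ?D y z * w z x * h x y)
       + (\<Sum>x\<in>V. \<Sum>y\<in>V. \<Sum>z\<in>V. ?D z x * h y z * h x y)"
    unfolding sum.distrib[symmetric] sum_subtractf[symmetric]
    by (intro sum.cong refl) (simp add: algebra_simps)
  also have "(\<Sum>x\<in>V. \<Sum>y\<in>V. \<Sum>z\<in>V. ?D x y * w z x * w y z) = (\<Sum>z\<in>V. \<Sum>x\<in>V. \<Sum>y\<in>V. ?D x y * w z x * w y z)"
    by (rule rot)
  also have "\<dots> \<le> c * real (card V)"
    using assms by (intro bound) auto
  also have "(\<Sum>x\<in>V. \<Sum>y\<in>V. \<Sum>z\<in>V. ?D y z * w z x * h x y) = (\<Sum>x\<in>V. \<Sum>y\<in>V. \<Sum>z\<in>V. ?D y z * h x y * w z x)"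
    by (simp add: mult_ac)
  also have "\<dots> \<le> c * real (card V)"
    using assms by (intro bound[of "\<lambda>x y. h x y" "\<lambda>x z. w z x"]) auto
  also have "(\<Sum>x\<in>V. \<Sum>y\<in>V. \<Sum>z\<in>V. ?D z x * h y z * h x y) = (\<Sum>y\<in>V. \<Sum>z\<in>V. \<Sum>x\<in>V. ?D z x * h y z * h x y)"
    by (rule trans[OF rot rot])
  also have "\<dots> \<le> c * real (card V)"
    using assms by (intro bound[of "\<lambda>y z. h y z" "\<lambda>y x. h x y"]) auto
  finally show ?thesis by simp
qed

section \<open>Triangle-free subgraphs of quasirandom digraphs\<close>

text \<open>The bound collects the arcs of \<open>H\<close> where the step function is at most
  \<open>\<delta>\<close>, half of the set \<open>C\<close> where it exceeds \<open>\<delta>\<close>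
  (supersaturation plus the diagonal), and a quasirandomness error for each of the at most
  \<open>16 ^ t\<close> boxes forming \<open>C\<close>.\<close>

lemma triangle_free_card_bound:
  fixes H T :: "('a \<times> 'a) set"
  assumes V: "finite V" "card V \<ge> k" "card V \<ge> 4" and k: "k \<ge> 3" and pos: "\<epsilon> > 0" "\<delta> > 0"
    and HT: "H \<subseteq> T" "H \<subseteq> V \<times> V"
    and free: "\<And>x y z. \<not> ((x, y) \<in> H \<and> (y, z) \<in> H \<and> (z, x) \<in> H)"
    and quasirandom: "\<And>A B. A \<subseteq> V \<Longrightarrow> B \<subseteq> V \<Longrightarrow>
      real (card (T \<inter> A \<times> B)) \<le> real (card A) * real (card B) / 2 + \<eta> * real (card V) ^ 2"
    and "\<eta> \<ge> 0"
  shows "\<exists>t. real t \<le> 1 / \<epsilon>\<^sup>2 \<and> real (card H) \<le> \<delta> * real (card V) ^ 2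
     + (real k / (2 * (real k - 1)) * real (card V) ^ 2 + 6 * real k ^ 3 * \<epsilon> / \<delta> ^ 3 * real (card V) ^ 2
        + real (card V)) / 2 + 16 ^ t * \<eta> * real (card V) ^ 2"
proof -
  define n where "n = real (card V)"
  have n: "n \<ge> 4" using V(3) by (simp add: n_def)
  define h :: "'a \<Rightarrow> 'a \<Rightarrow> real" where "h x y = of_bool ((x, y) \<in> H)" for x y
  have h01: "0 \<le> h x y \<and> h x y \<le> 1" for x y by (simp add: h_def)
  have "V \<noteq> {}" using V by auto
  from weak_regularity[OF V(1) this pos(1), of h] h01 obtain t and p :: "'a \<Rightarrow> bool list"
    where t: "real t \<le> 1 / \<epsilon>\<^sup>2" and p: "\<And>x. length (p x) = 2 * t"
      and cut: "\<And>S T. S \<subseteq> V \<Longrightarrow> T \<subseteq> V \<Longrightarrow>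
        \<bar>\<Sum>x\<in>S. \<Sum>y\<in>T. h x y - class_average V p h x y\<bar> \<le> \<epsilon> * n\<^sup>2"
    unfolding n_def by blast
  define w where "w = class_average V p h"
  have w01: "0 \<le> w x y \<and> w x y \<le> 1" if "x \<in> V" "y \<in> V" for x y
    using class_average_bounds[where p = p, OF V(1) h01 that] by (simp add: w_def)
  define C where "C = {(x, y) \<in> V \<times> V. w x y > \<delta>}"
  have finC: "finite C" by (rule finite_subset[of _ "V \<times> V"]) (auto simp: C_def V(1))
  have finT: "finite (T \<inter> V \<times> V)" using V(1) by simp

  have www: "(\<Sum>x\<in>V. \<Sum>y\<in>V. \<Sum>z\<in>V. w x y * w y z * w z x) \<le> 3 * \<epsilon> * n ^ 3"
  proof -
    have "(\<Sum>x\<in>V. \<Sum>y\<in>V. \<Sum>z\<in>V. w x y * w y z * w z x)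
       \<le> (\<Sum>x\<in>V. \<Sum>y\<in>V. \<Sum>z\<in>V. h x y * h y z * h z x) + 3 * (\<epsilon> * n\<^sup>2) * real (card V)"
    proof (rule triangle_counting[OF V(1) _ h01 w01])
      fix S T assume "S \<subseteq> V" "T \<subseteq> V"
      from cut[OF this] have "- (\<Sum>x\<in>S. \<Sum>y\<in>T. h x y - w x y) \<le> \<epsilon> * n\<^sup>2"
        unfolding w_def by linarith
      then show "(\<Sum>x\<in>S. \<Sum>y\<in>T. w x y - h x y) \<le> \<epsilon> * n\<^sup>2"
        by (simp add: sum_negf[symmetric])
    qed
    also have "(\<Sum>x\<in>V. \<Sum>y\<in>V. \<Sum>z\<in>V. h x y * h y z * h z x) = 0"
    proof (intro sum.neutral ballI)
      fix x y z
      show "h x y * h y z * h z x = 0" using free[of x y z] by (auto simp: h_def)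
    qed
    finally show ?thesis by (simp add: n_def power3_eq_cube power2_eq_square mult_ac)
  qed
  \<comment> \<open>Every triangle of \<open>C\<close> contributes at least
    \<open>\<delta> ^ 3\<close> to the triangle weight of \<open>w\<close>, which \<open>www\<close>
    shows to be small.\<close>
  have "real (card (triangles_on C V)) * \<delta> ^ 3 = (\<Sum>(x, y, z)\<in>triangles_on C V. \<delta> * \<delta> * \<delta>)"
    by (simp add: power3_eq_cube)
  also have "\<dots> \<le> (\<Sum>(x, y, z)\<in>triangles_on C V. w x y * w y z * w z x)"
    using pos(2) w01
    by (intro sum_mono) (auto simp: triangles_on_def C_def intro!: mult_mono mult_nonneg_nonneg)
  also have "\<dots> \<le> (\<Sum>(x, y, z)\<in>V \<times> V \<times> V. w x y * w y z * w z x)"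
    using V(1) w01 by (intro sum_mono2) (auto simp: triangles_on_def intro!: mult_nonneg_nonneg)
  also have "\<dots> = (\<Sum>x\<in>V. \<Sum>y\<in>V. \<Sum>z\<in>V. w x y * w y z * w z x)"
    by (simp add: sum.cartesian_product split_def)
  also note www
  finally have tri: "real (card (triangles_on C V)) \<le> 3 * \<epsilon> * n ^ 3 / \<delta> ^ 3"
    using pos(2) by (simp add: field_simps)

  have "real (card (arcs_on C V)) \<le> real k / (2 * (real k - 1)) * (n * (n - 1))
           + real k ^ 3 * real (card (triangles_on C V)) / (n - 2)"
    unfolding n_def by (rule supersaturation[OF V(1) k V(2)])
  \<comment> \<open>The denominator uses \<open>n - 2 \<ge> n / 2\<close>, which holds as
    \<open>n \<ge> 4\<close>.\<close>
  also have "\<dots> \<le> real k / (2 * (real k - 1)) * n\<^sup>2 + real k ^ 3 * (3 * \<epsilon> * n ^ 3 / \<delta> ^ 3) / (n / 2)"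
  proof (rule add_mono)
    show "real k / (2 * (real k - 1)) * (n * (n - 1)) \<le> real k / (2 * (real k - 1)) * n\<^sup>2"
      using k n by (intro mult_left_mono) (auto simp: power2_eq_square)
    show "real k ^ 3 * real (card (triangles_on C V)) / (n - 2)
        \<le> real k ^ 3 * (3 * \<epsilon> * n ^ 3 / \<delta> ^ 3) / (n / 2)"
      using tri n pos by (intro frac_le mult_left_mono) auto
  qed
  also have "real k ^ 3 * (3 * \<epsilon> * n ^ 3 / \<delta> ^ 3) / (n / 2) = 6 * real k ^ 3 * \<epsilon> / \<delta> ^ 3 * n\<^sup>2"
    using n pos by (simp add: field_simps power3_eq_cube power2_eq_square)
  finally have arcs: "real (card (arcs_on C V))
      \<le> real k / (2 * (real k - 1)) * n\<^sup>2 + 6 * real k ^ 3 * \<epsilon> / \<delta> ^ 3 * n\<^sup>2" .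
  have "C \<subseteq> arcs_on C V \<union> (\<lambda>x. (x, x)) ` V" by (auto simp: C_def arcs_on_def)
  then have "card C \<le> card (arcs_on C V \<union> (\<lambda>x. (x, x)) ` V)"
    using V(1) by (intro card_mono) (auto simp: finite_arcs_on)
  also have "\<dots> \<le> card (arcs_on C V) + card V"
    by (meson V(1) add_left_mono card_Un_le card_image_le order_trans)
  finally have cardC: "real (card C)
      \<le> real k / (2 * (real k - 1)) * n\<^sup>2 + 6 * real k ^ 3 * \<epsilon> / \<delta> ^ 3 * n\<^sup>2 + n"
    using arcs unfolding n_def by linarith

  \<comment> \<open>Since \<open>w\<close> is constant on boxes, \<open>C\<close> is a union of
    boxes, and \<open>Q\<close> lists their label pairs. Labels have \<open>2 * t\<close> bits, so
    there are at most \<open>4 ^ t * 4 ^ t\<close> of these.\<close>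
  define Q where "Q = (\<lambda>(x, y). (p x, p y)) ` C"
  define box where "box = (\<lambda>(l, l'). {x \<in> V. p x = l} \<times> {y \<in> V. p y = l'})"
  have finQ: "finite Q" using finC by (simp add: Q_def)
  have w_cong: "w x y = w x' y'" if "x \<in> V" "x' \<in> V" "y \<in> V" "y' \<in> V" "p x = p x'" "p y = p y'" for x x' y y'
    using class_invariant_average[of V p h] that unfolding class_invariant_def w_def by blast
  have C_box: "C = (\<Union>q\<in>Q. box q)"
  proof
    show "C \<subseteq> (\<Union>q\<in>Q. box q)" by (force simp: C_def Q_def box_def)
    show "(\<Union>q\<in>Q. box q) \<subseteq> C"
    proof
      fix e assume "e \<in> (\<Union>q\<in>Q. box q)"
      then obtain x y x' y' where "e = (x', y')" "(x, y) \<in> C" "x' \<in> V" "y' \<in> V" "p x' = p x" "p y' = p y"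
        by (auto simp: Q_def box_def)
      then show "e \<in> C" using w_cong[of x x' y y'] by (auto simp: C_def)
    qed
  qed
  have disj: "box q \<inter> box q' = {}" if "q \<noteq> q'" for q q'
    using that by (auto simp: box_def split: prod.splits)
  have fin_box: "finite (box q)" for q using V(1) by (auto simp: box_def split: prod.splits)
  define L where "L = {l :: bool list. length l = 2 * t}"
  have L: "finite L" "card L = 4 ^ t"
    using finite_lists_length_eq[of "UNIV :: bool set" "2 * t"] card_lists_length_eq[of "UNIV :: bool set" "2 * t"]
    by (simp_all add: L_def power_mult)
  have "card Q \<le> card (L \<times> L)"
    using L by (intro card_mono) (auto simp: Q_def L_def p)
  also have "\<dots> = 16 ^ t" by (simp add: card_cartesian_product L flip: power_mult_distrib)
  finally have cardQ: "real (card Q) \<le> 16 ^ t"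
    by (metis of_nat_le_iff of_nat_numeral of_nat_power)
  have card_C: "card C = (\<Sum>q\<in>Q. card (box q))"
    by (subst C_box, rule card_UN_disjoint) (use finQ fin_box disj in blast)+
  have "T \<inter> C = (\<Union>q\<in>Q. T \<inter> box q)" by (subst C_box) blast
  then have "card (T \<inter> C) = card (\<Union>q\<in>Q. T \<inter> box q)" by (rule arg_cong)
  also have "\<dots> = (\<Sum>q\<in>Q. card (T \<inter> box q))"
    by (rule card_UN_disjoint) (use finQ fin_box disj in blast)+
  finally have "real (card (T \<inter> C)) = (\<Sum>q\<in>Q. real (card (T \<inter> box q)))" by simp
  also have "\<dots> \<le> (\<Sum>q\<in>Q. real (card (box q)) / 2 + \<eta> * n\<^sup>2)"
  proof (rule sum_mono)
    fix q assume "q \<in> Q"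
    show "real (card (T \<inter> box q)) \<le> real (card (box q)) / 2 + \<eta> * n\<^sup>2"
      using quasirandom[of "{x \<in> V. p x = fst q}" "{x \<in> V. p x = snd q}"]
      by (auto simp: box_def n_def card_cartesian_product split_def)
  qed
  also have "\<dots> = real (card C) / 2 + real (card Q) * (\<eta> * n\<^sup>2)"
    by (simp add: card_C sum.distrib sum_divide_distrib)
  also have "\<dots> \<le> real (card C) / 2 + 16 ^ t * (\<eta> * n\<^sup>2)"
    using cardQ \<open>\<eta> \<ge> 0\<close> by (intro add_left_mono mult_right_mono) auto
  finally have TC: "real (card (T \<inter> C)) \<le> real (card C) / 2 + 16 ^ t * \<eta> * n\<^sup>2" by simp

  have sum_h: "(\<Sum>x\<in>V. \<Sum>y\<in>V. h x y * of_bool ((x, y) \<in> B)) = real (card (H \<inter> B))" if "B \<subseteq> V \<times> V" for B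
  proof -
    have "(\<Sum>x\<in>V. \<Sum>y\<in>V. h x y * of_bool ((x, y) \<in> B)) = (\<Sum>e\<in>V \<times> V. if e \<in> H \<inter> B then 1 else 0)"
      by (simp add: sum.cartesian_product h_def) (intro sum.cong refl, auto)
    also have "\<dots> = real (card ((V \<times> V) \<inter> (H \<inter> B)))"
      using V(1) by (simp add: sum.If_cases Int_def)
    also have "(V \<times> V) \<inter> (H \<inter> B) = H \<inter> B" using that by blast
    finally show ?thesis .
  qed
  \<comment> \<open>The total of \<open>h\<close> equals that of \<open>w\<close>. Off
    \<open>C\<close> every pair costs at most \<open>\<delta>\<close>; on \<open>C\<close> the total
    of \<open>w\<close> turns back into that of \<open>h\<close>, because \<open>C\<close> is a
    union of boxes.\<close>
  have "real (card H) = real (card (H \<inter> V \<times> V))" using HT(2) by (simp add: Int_absorb2)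
  also have "\<dots> = (\<Sum>x\<in>V. \<Sum>y\<in>V. h x y * of_bool ((x, y) \<in> V \<times> V))" by (simp only: sum_h order_refl)
  also have "\<dots> = (\<Sum>x\<in>V. \<Sum>y\<in>V. w x y * of_bool ((x, y) \<in> V \<times> V))"
    unfolding w_def by (rule sum_class_average_mult[symmetric, OF V(1)]) (auto simp: class_invariant_def)
  also have "\<dots> \<le> (\<Sum>x\<in>V. \<Sum>y\<in>V. \<delta> + w x y * of_bool ((x, y) \<in> C))"
    using pos(2) w01 by (intro sum_mono) (auto simp: C_def)
  also have "\<dots> = \<delta> * n\<^sup>2 + (\<Sum>x\<in>V. \<Sum>y\<in>V. w x y * of_bool ((x, y) \<in> C))"
    by (simp add: sum.distrib n_def power2_eq_square)
  also have "(\<Sum>x\<in>V. \<Sum>y\<in>V. w x y * of_bool ((x, y) \<in> C)) = (\<Sum>x\<in>V. \<Sum>y\<in>V. h x y * of_bool ((x, y) \<in> C))"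
    unfolding w_def
  proof (rule sum_class_average_mult[OF V(1)])
    show "class_invariant V p (\<lambda>x y. of_bool ((x, y) \<in> C))"
      unfolding class_invariant_def
    proof (intro ballI impI)
      fix x x' y y' assume "x \<in> V" "x' \<in> V" "y \<in> V" "y' \<in> V" "p x = p x'" "p y = p y'"
      then show "(of_bool ((x, y) \<in> C) :: real) = of_bool ((x', y') \<in> C)"
        using w_cong[of x x' y y'] by (simp add: C_def)
    qed
  qed
  also have "\<dots> = real (card (H \<inter> C))" by (rule sum_h) (auto simp: C_def)
  finally have "real (card H) \<le> \<delta> * n\<^sup>2 + real (card (H \<inter> C))" .
  moreover have "real (card (H \<inter> C)) \<le> real (card (T \<inter> C))"
    using HT(1) finC by (intro of_nat_mono card_mono) auto
  \<comment> \<open>A bare linear fact, so that the nonlinear bounds can be combined as opaque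
    terms.\<close>
  moreover have "x \<le> d + f / 2 + e" if "x \<le> d + y" "y \<le> z" "z \<le> c / 2 + e" "c \<le> f" for x d y z c e f :: real
    using that by linarith
  ultimately have "real (card H) \<le> \<delta> * n\<^sup>2 + (real k / (2 * (real k - 1)) * n\<^sup>2
      + 6 * real k ^ 3 * \<epsilon> / \<delta> ^ 3 * n\<^sup>2 + n) / 2 + 16 ^ t * \<eta> * n\<^sup>2"
    using TC cardC by blast
  then show ?thesis using t unfolding n_def by blast
qed

text \<open>The order of quantifiers matters: \<open>\<eta>\<close> depends on
  \<open>\<gamma>\<close> alone, so a single quasirandomness event serves all triangle-free
  \<open>H\<close> at once.\<close>

lemma triangle_free_subset_of_quasirandom:
  assumes "\<gamma> > 0"
  shows "\<exists>\<eta>>0. \<exists>n0. \<forall>V (T :: ('a \<times> 'a) set) H. finite V \<longrightarrow> card V \<ge> n0 \<longrightarrow> H \<subseteq> T \<longrightarrow> H \<subseteq> V \<times> V \<longrightarrow>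
    (\<forall>x y z. \<not> ((x, y) \<in> H \<and> (y, z) \<in> H \<and> (z, x) \<in> H)) \<longrightarrow>
    (\<forall>A B. A \<subseteq> V \<longrightarrow> B \<subseteq> V \<longrightarrow>
      real (card (T \<inter> A \<times> B)) \<le> real (card A) * real (card B) / 2 + \<eta> * real (card V) ^ 2) \<longrightarrow>
    real (card H) \<le> (1 / 4 + \<gamma>) * real (card V) ^ 2"
proof -
  \<comment> \<open>Five error terms are each brought down to \<open>\<gamma> / 8 * n^2\<close>: the
    one from \<open>\<delta>\<close>; the excess of \<open>k / (2 * (k - 1))\<close> over
    \<open>1 / 2\<close>, the triangle term and the diagonal, controlled by \<open>k\<close>,
    \<open>\<epsilon>\<close> and \<open>n0\<close> (each \<open>\<gamma> / 4\<close> before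
    halving); and the box errors, where \<open>t0\<close> bounds the number of rounds.\<close>
  define \<delta> where "\<delta> = \<gamma> / 8"
  define k where "k = nat \<lceil>2 / \<gamma>\<rceil> + 3"
  define \<epsilon> where "\<epsilon> = \<gamma> * \<delta> ^ 3 / (24 * real k ^ 3)"
  define t0 where "t0 = nat \<lfloor>1 / \<epsilon>\<^sup>2\<rfloor>"
  define \<eta> where "\<eta> = \<gamma> / (8 * 16 ^ t0)"
  define n0 where "n0 = k + 4 + nat \<lceil>4 / \<gamma>\<rceil>"
  have k3: "k \<ge> 3" by (simp add: k_def)
  have kg: "real k - 1 \<ge> 2 / \<gamma>" unfolding k_def using real_nat_ceiling_ge[of "2 / \<gamma>"] by simp
  have pos: "\<delta> > 0" "\<epsilon> > 0" "\<eta> > 0"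
    using assms k3 by (simp_all add: \<delta>_def \<epsilon>_def \<eta>_def)
  show ?thesis
  proof (intro exI[of _ \<eta>] conjI exI[of _ n0] allI impI)
    fix V and T H :: "('a \<times> 'a) set"
    assume *: "finite V" "n0 \<le> card V" "H \<subseteq> T" "H \<subseteq> V \<times> V"
      "\<forall>x y z. \<not> ((x, y) \<in> H \<and> (y, z) \<in> H \<and> (z, x) \<in> H)"
      "\<forall>A B. A \<subseteq> V \<longrightarrow> B \<subseteq> V \<longrightarrow>
        real (card (T \<inter> A \<times> B)) \<le> real (card A) * real (card B) / 2 + \<eta> * real (card V) ^ 2"
    let ?n = "real (card V)"
    have ge: "card V \<ge> k" "card V \<ge> 4" using *(2) by (simp_all add: n0_def)
    obtain t where t: "real t \<le> 1 / \<epsilon>\<^sup>2" "real (card H) \<le> \<delta> * ?n ^ 2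
       + (real k / (2 * (real k - 1)) * ?n ^ 2 + 6 * real k ^ 3 * \<epsilon> / \<delta> ^ 3 * ?n ^ 2 + ?n) / 2
       + 16 ^ t * \<eta> * ?n ^ 2"
      using triangle_free_card_bound[OF *(1) ge k3 pos(2,1) *(3,4), of \<eta>] *(5,6) pos(3) by auto
    have "t \<le> t0" using t(1) unfolding t0_def by (simp add: le_nat_floor)
    then have "16 ^ t * \<eta> \<le> 16 ^ t0 * \<eta>" using pos(3) by (intro mult_right_mono power_increasing) auto
    also have "\<dots> = \<gamma> / 8" by (simp add: \<eta>_def)
    finally have b1: "16 ^ t * \<eta> * ?n ^ 2 \<le> \<gamma> / 8 * ?n ^ 2" by (rule mult_right_mono) simp
    have "6 * real k ^ 3 * \<epsilon> / \<delta> ^ 3 = \<gamma> / 4"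
      using k3 pos by (simp add: \<epsilon>_def field_simps)
    then have b2: "6 * real k ^ 3 * \<epsilon> / \<delta> ^ 3 * ?n ^ 2 = \<gamma> / 4 * ?n ^ 2" by (simp only:)
    have "real k / (2 * (real k - 1)) = 1 / 2 + 1 / (2 * (real k - 1))"
      using k3 by (simp add: field_simps)
    also have "1 / (2 * (real k - 1)) \<le> \<gamma> / 4"
      using kg assms k3 by (simp add: field_simps)
    finally have b3: "real k / (2 * (real k - 1)) * ?n ^ 2 \<le> (1 / 2 + \<gamma> / 4) * ?n ^ 2"
      by (intro mult_right_mono) auto
    have "?n \<ge> 4 / \<gamma>"
      using *(2) real_nat_ceiling_ge[of "4 / \<gamma>"] unfolding n0_def by linarith
    then have "4 \<le> \<gamma> * ?n" using assms by (simp add: field_simps)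
    then have "4 * ?n \<le> \<gamma> * ?n * ?n" by (rule mult_right_mono) simp
    then have b4: "?n \<le> \<gamma> / 4 * ?n ^ 2" by (simp add: power2_eq_square)
    have "real (card H) \<le> \<gamma> / 8 * ?n ^ 2 + ((1 / 2 + \<gamma> / 4) * ?n ^ 2 + \<gamma> / 4 * ?n ^ 2 + \<gamma> / 4 * ?n ^ 2) / 2
        + \<gamma> / 8 * ?n ^ 2"
      using t(2) b1 b2 b3 b4 unfolding \<delta>_def by argo
    also have "\<dots> = (1 / 4 + 5 / 8 * \<gamma>) * ?n ^ 2" by (simp add: field_simps)
    also have "\<dots> \<le> (1 / 4 + \<gamma>) * ?n ^ 2" using assms by (intro mult_right_mono) auto
    finally show "real (card H) \<le> (1 / 4 + \<gamma>) * ?n ^ 2" .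
  qed (rule pos(3))
qed

section \<open>Random tournaments\<close>

abbreviation fair_coins :: "nat \<Rightarrow> (nat \<times> nat \<Rightarrow> bool) pmf" where
  "fair_coins n \<equiv> Pi_pmf (vertex_pairs n) False (\<lambda>_. bernoulli_pmf (1 / 2))"

section \<open>Arc counts and deterministic bounds\<close>

lemma parcs_orientation_iff:
  "(x, y) \<in> parcs (orientation n b) \<longleftrightarrow>
     (x, y) \<in> vertex_pairs n \<and> b (x, y) \<or> (y, x) \<in> vertex_pairs n \<and> \<not> b (y, x)"
  by (auto simp: orientation_def)

lemma parcs_orientation_subset: "parcs (orientation n b) \<subseteq> {..<n} \<times> {..<n}"
  by (auto simp: orientation_def vertex_pairs_def)

lemma finite_parcs_orientation: "finite (parcs (orientation n b))"
  by (rule finite_subset[OF parcs_orientation_subset]) simp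

lemma card_vertex_pairs: "real (card (vertex_pairs n)) = real n * (real n - 1) / 2"
proof -
  have "card {(x, y) \<in> {..<n} \<times> {..<n}. x \<noteq> y} = n * (n - 1)"
    using card_off_diagonal[of "{..<n}"] by simp
  also have "{(x, y) \<in> {..<n} \<times> {..<n}. x \<noteq> y} = vertex_pairs n \<union> (vertex_pairs n)\<inverse>"
    by (auto simp: vertex_pairs_def)
  also have "card \<dots> = 2 * card (vertex_pairs n)"
    by (subst card_Un_disjoint) (auto simp: finite_vertex_pairs, auto simp: vertex_pairs_def)
  finally have "2 * real (card (vertex_pairs n)) = real (n * (n - 1))" by (metis of_nat_mult of_nat_numeral)
  then show ?thesis by (cases n) (auto simp: algebra_simps)
qed

lemma card_parcs_orientation: "card (parcs (orientation n b)) = card (vertex_pairs n)"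
proof -
  let ?f = "\<lambda>(i, j). if b (i, j) then (i, j) else (j, i)"
  have "parcs (orientation n b) = ?f ` vertex_pairs n"
  proof
    show "?f ` vertex_pairs n \<subseteq> parcs (orientation n b)"
    proof (rule image_subsetI)
      fix e assume "e \<in> vertex_pairs n"
      then show "?f e \<in> parcs (orientation n b)" by (cases e) (simp add: parcs_orientation_iff)
    qed
    show "parcs (orientation n b) \<subseteq> ?f ` vertex_pairs n"
    proof (rule subrelI)
      fix x y assume "(x, y) \<in> parcs (orientation n b)"
      then have "(x, y) \<in> vertex_pairs n \<and> ?f (x, y) = (x, y) \<or> (y, x) \<in> vertex_pairs n \<and> ?f (y, x) = (x, y)"
        by (auto simp: parcs_orientation_iff)
      then show "(x, y) \<in> ?f ` vertex_pairs n"
        by (elim disjE conjE) (rule image_eqI[OF sym], assumption+)+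
    qed
  qed
  moreover have "inj_on ?f (vertex_pairs n)"
    by (auto simp: inj_on_def vertex_pairs_def split: if_splits)
  ultimately show ?thesis by (simp add: card_image)
qed

lemma tau_t_le:
  assumes "finite (parcs D)" "F \<subseteq> parcs D" "directed_triangles (D\<lparr>parcs := parcs D - F\<rparr>) = {}"
  shows "tau_t D \<le> card F"
  unfolding tau_t_def
proof (rule Min_le)
  show "finite {card F | F. F \<subseteq> parcs D \<and> directed_triangles (D\<lparr>parcs := parcs D - F\<rparr>) = {}}"
    by (rule finite_subset[of _ "card ` Pow (parcs D)"]) (use assms(1) in auto)
qed (use assms in auto)

lemma nu_t_ge:
  assumes "finite (parcs D)" "T \<subseteq> directed_triangles D" "disjoint T"
  shows "card T \<le> nu_t D"
  unfolding nu_t_def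
proof (rule Max_ge)
  show "finite {card T | T. T \<subseteq> directed_triangles D \<and> disjoint T}"
    by (rule finite_subset[of _ "card ` Pow (directed_triangles D)"])
       (use finite_directed_triangles[OF assms(1)] in auto)
qed (use assms in auto)

lemma card_directed_triangle:
  assumes "t \<in> directed_triangles D"
  shows "card t = 3"
  using assms by (auto simp: directed_triangles_def)

lemma nu_t_upper:
  assumes "finite (parcs D)"
  shows "3 * nu_t D \<le> card (parcs D)"
proof -
  obtain T where T: "T \<subseteq> directed_triangles D" "disjoint T" "nu_t D = card T"
    using nu_t_attained[OF assms] by blast
  have "finite T" using T(1) finite_directed_triangles[OF assms] finite_subset by blast
  have "card (\<Union>T) = (\<Sum>t\<in>T. card t)"
    using T by (intro card_Union_disjoint) (auto simp: disjoint_def pairwise_def disjnt_def directed_triangles_def)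
  also have "\<dots> = (\<Sum>t\<in>T. 3)"
    using T(1) by (intro sum.cong refl card_directed_triangle) auto
  finally have "3 * nu_t D = card (\<Union>T)" using T(3) by simp
  also have "\<dots> \<le> card (parcs D)"
    using T(1) assms by (intro card_mono) (auto simp: directed_triangles_def)
  finally show ?thesis .
qed

text \<open>Without the increasing arcs all others decrease and close no cycle, and vice versa. The
  smaller of the two classes has at most half of the \<open>n * (n - 1) / 2\<close> arcs.\<close>

lemma tau_t_orientation_upper: "real (tau_t (orientation n b)) \<le> real n ^ 2 / 4"
proof -
  let ?D = "orientation n b"
  define F1 where "F1 = {(x, y) \<in> parcs ?D. x < y}"
  define F2 where "F2 = {(x, y) \<in> parcs ?D. y < x}"
  have sub: "F1 \<subseteq> parcs ?D" "F2 \<subseteq> parcs ?D" by (auto simp: F1_def F2_def)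
  have fin: "finite F1" "finite F2"
    using sub finite_parcs_orientation finite_subset by blast+
  have "tau_t ?D \<le> card F1"
    by (rule tau_t_le[OF finite_parcs_orientation sub(1)]) (auto simp: directed_triangles_def F1_def)
  moreover have "tau_t ?D \<le> card F2"
    by (rule tau_t_le[OF finite_parcs_orientation sub(2)]) (auto simp: directed_triangles_def F2_def)
  moreover have "card F1 + card F2 = card (F1 \<union> F2)"
    by (subst card_Un_disjoint) (auto simp: fin, auto simp: F1_def F2_def)
  moreover have "card (F1 \<union> F2) \<le> card (parcs ?D)"
    using sub by (intro card_mono finite_parcs_orientation) auto
  ultimately have "2 * tau_t ?D \<le> card (vertex_pairs n)"
    by (simp add: card_parcs_orientation)
  then have "2 * real (tau_t ?D) \<le> real (card (vertex_pairs n))" by linarith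
  then show ?thesis by (simp add: card_vertex_pairs power2_eq_square algebra_simps)
qed

section \<open>Quasirandomness of the random tournament\<close>

text \<open>Each unordered pair contributes \<open>0\<close> or \<open>1\<close> to the count,
  according to its own coin, so Hoeffding's inequality applies. With at most \<open>n^2 / 2\<close>
  pairs the exponent is at least \<open>2 * (\<eta> * n^2)^2 / (n^2 / 2)\<close> in absolute
  value.\<close>

lemma prob_cut_deviation:
  assumes n: "n \<ge> 2" and \<eta>: "\<eta> > 0" and AB: "A \<subseteq> {..<n}" "B \<subseteq> {..<n}"
  shows "measure_pmf.prob (fair_coins n)
      {b. real (card (parcs (orientation n b) \<inter> A \<times> B)) > real (card A) * real (card B) / 2 + \<eta> * real n ^ 2}
    \<le> exp (- 4 * \<eta>\<^sup>2 * real n ^ 2)"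
proof -
  define X :: "nat \<times> nat \<Rightarrow> (nat \<times> nat \<Rightarrow> bool) \<Rightarrow> real" where
    "X = (\<lambda>(i, j) b. if b (i, j) then of_bool (i \<in> A \<and> j \<in> B) else of_bool (j \<in> A \<and> i \<in> B))"
  define Y :: "nat \<times> nat \<Rightarrow> bool \<Rightarrow> real" where
    "Y = (\<lambda>(i, j) c. if c then of_bool (i \<in> A \<and> j \<in> B) else of_bool (j \<in> A \<and> i \<in> B))"
  have XY: "X e = (\<lambda>b. Y e (b e))" for e by (auto simp: X_def Y_def split: prod.splits)
  have fin: "finite (vertex_pairs n)" by (rule finite_vertex_pairs)
  have indep: "prob_space.indep_vars (measure_pmf (fair_coins n)) (\<lambda>_. borel) X (vertex_pairs n)"
    unfolding XY
    by (rule prob_space.indep_vars_compose2[OF measure_pmf.prob_space_axioms indep_vars_Pi_pmf[OF fin]]) simp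
  interpret H: Hoeffding_ineq "measure_pmf (fair_coins n)" "vertex_pairs n" X "\<lambda>_. 0" "\<lambda>_. 1"
    "\<Sum>e\<in>vertex_pairs n. measure_pmf.expectation (fair_coins n) (X e)"
    by unfold_locales (use indep fin in \<open>auto simp: X_def split: prod.splits intro!: AE_I2\<close>)
  have exp_X: "measure_pmf.expectation (fair_coins n) (X (i, j))
      = (of_bool (i \<in> A \<and> j \<in> B) + of_bool (j \<in> A \<and> i \<in> B)) / 2" if "(i, j) \<in> vertex_pairs n" for i j
  proof -
    have "measure_pmf.expectation (fair_coins n) (X (i, j))
        = measure_pmf.expectation (map_pmf (\<lambda>b. b (i, j)) (fair_coins n)) (Y (i, j))"
      by (simp add: XY)
    also have "map_pmf (\<lambda>b. b (i, j)) (fair_coins n) = bernoulli_pmf (1 / 2)"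
      using that by (subst Pi_pmf_component) (auto simp: fin)
    finally show ?thesis by (simp add: Y_def)
  qed
  have sum_pairs: "(\<Sum>(i, j)\<in>vertex_pairs n. g (i, j) + g (j, i)) = (\<Sum>e\<in>vertex_pairs n \<union> (vertex_pairs n)\<inverse>. g e)"
    for g :: "nat \<times> nat \<Rightarrow> real"
  proof -
    have "(\<Sum>e\<in>vertex_pairs n \<union> (vertex_pairs n)\<inverse>. g e) = (\<Sum>e\<in>vertex_pairs n. g e) + (\<Sum>e\<in>(vertex_pairs n)\<inverse>. g e)"
      by (rule sum.union_disjoint) (auto simp: fin, auto simp: vertex_pairs_def)
    also have "(\<Sum>e\<in>(vertex_pairs n)\<inverse>. g e) = (\<Sum>(i, j)\<in>vertex_pairs n. g (j, i))"
      by (rule sum.reindex_bij_witness[of _ prod.swap prod.swap]) auto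
    finally show ?thesis by (simp add: sum.distrib split_def)
  qed
  \<comment> \<open>This is only an inequality: the pairs \<open>(x, x)\<close> with
    \<open>x\<close> in both \<open>A\<close> and \<open>B\<close> are never arcs.\<close>
  have mean: "(\<Sum>e\<in>vertex_pairs n. measure_pmf.expectation (fair_coins n) (X e)) \<le> real (card A) * real (card B) / 2"
  proof -
    have "(\<Sum>e\<in>vertex_pairs n. measure_pmf.expectation (fair_coins n) (X e))
        = (\<Sum>(i, j)\<in>vertex_pairs n. of_bool ((i, j) \<in> A \<times> B) / 2 + of_bool ((j, i) \<in> A \<times> B) / 2)"
      by (intro sum.cong refl) (auto simp: exp_X add_divide_distrib)
    also have "\<dots> = (\<Sum>e\<in>vertex_pairs n \<union> (vertex_pairs n)\<inverse>. of_bool (e \<in> A \<times> B) / 2)"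
      by (rule sum_pairs)
    also have "\<dots> = real (card ((vertex_pairs n \<union> (vertex_pairs n)\<inverse>) \<inter> A \<times> B)) / 2"
      using fin by (simp add: sum_of_bool_eq Int_def flip: sum_divide_distrib)
    also have "\<dots> \<le> real (card (A \<times> B)) / 2"
      using AB by (intro divide_right_mono of_nat_mono card_mono) (auto intro: finite_subset)
    finally show ?thesis by (simp add: card_cartesian_product)
  qed
  have sum_X: "real (card (parcs (orientation n b) \<inter> A \<times> B)) = (\<Sum>e\<in>vertex_pairs n. X e b)" for b
  proof -
    have "(\<Sum>e\<in>vertex_pairs n. X e b) = (\<Sum>(i, j)\<in>vertex_pairs n.
        of_bool ((i, j) \<in> parcs (orientation n b) \<inter> A \<times> B) + of_bool ((j, i) \<in> parcs (orientation n b) \<inter> A \<times> B))"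
      by (intro sum.cong refl) (auto simp: X_def orientation_def vertex_pairs_def)
    also have "\<dots> = (\<Sum>e\<in>vertex_pairs n \<union> (vertex_pairs n)\<inverse>. of_bool (e \<in> parcs (orientation n b) \<inter> A \<times> B))"
      by (rule sum_pairs)
    also have "\<dots> = real (card ((vertex_pairs n \<union> (vertex_pairs n)\<inverse>) \<inter> (parcs (orientation n b) \<inter> A \<times> B)))"
      using fin by (simp add: sum_of_bool_eq Int_def)
    also have "(vertex_pairs n \<union> (vertex_pairs n)\<inverse>) \<inter> (parcs (orientation n b) \<inter> A \<times> B) = parcs (orientation n b) \<inter> A \<times> B"
      by (auto simp: orientation_def)
    finally show ?thesis by simp
  qed
  \<comment> \<open>Hoeffding's bound divides by the number of pairs, which is positive as
    \<open>n \<ge> 2\<close>.\<close>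
  have pos: "card (vertex_pairs n) > 0"
  proof -
    have "(0, 1) \<in> vertex_pairs n" using n by (simp add: vertex_pairs_def)
    then show ?thesis using fin by (auto simp: card_gt_0_iff)
  qed
  have "measure_pmf.prob (fair_coins n)
      {b. real (card (parcs (orientation n b) \<inter> A \<times> B)) > real (card A) * real (card B) / 2 + \<eta> * real n ^ 2}
    \<le> measure_pmf.prob (fair_coins n) {b \<in> space (measure_pmf (fair_coins n)).
        (\<Sum>e\<in>vertex_pairs n. X e b) \<ge> (\<Sum>e\<in>vertex_pairs n. measure_pmf.expectation (fair_coins n) (X e)) + \<eta> * real n ^ 2}"
    using mean by (intro measure_pmf.finite_measure_mono) (auto simp: sum_X)
  also have "\<dots> \<le> exp (- 2 * (\<eta> * real n ^ 2)\<^sup>2 / (\<Sum>e\<in>vertex_pairs n. (1 - 0)\<^sup>2))"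
    using \<eta> pos by (intro H.Hoeffding_ineq_ge) auto
  also have "\<dots> \<le> exp (- 4 * \<eta>\<^sup>2 * real n ^ 2)"
  proof -
    have "4 * \<eta>\<^sup>2 * real n ^ 2 = 2 * (\<eta> * real n ^ 2)\<^sup>2 / (real n ^ 2 / 2)"
      using n by (simp add: field_simps power2_eq_square)
    also have "\<dots> \<le> 2 * (\<eta> * real n ^ 2)\<^sup>2 / real (card (vertex_pairs n))"
    proof (rule divide_left_mono)
      show "real (card (vertex_pairs n)) \<le> real n ^ 2 / 2"
        by (simp add: card_vertex_pairs power2_eq_square algebra_simps)
    qed (use pos n in auto)
    finally show ?thesis by simp
  qed
  finally show ?thesis .
qed

definition quasirandom :: "real \<Rightarrow> nat \<Rightarrow> (nat \<times> nat) set \<Rightarrow> bool" where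
  "quasirandom \<eta> n T \<longleftrightarrow> (\<forall>A B. A \<subseteq> {..<n} \<longrightarrow> B \<subseteq> {..<n} \<longrightarrow>
      real (card (T \<inter> A \<times> B)) \<le> real (card A) * real (card B) / 2 + \<eta> * real n ^ 2)"

text \<open>A union bound: \<open>4 ^ n\<close> choices of two vertex sets, against a failure
  probability exponentially small in \<open>n^2\<close>.\<close>

lemma quasirandom_whp:
  assumes \<eta>: "\<eta> > 0"
  shows "(\<lambda>n. measure_pmf.prob (fair_coins n) {b. \<not> quasirandom \<eta> n (parcs (orientation n b))}) \<longlonglongrightarrow> 0"
proof (rule tendsto_sandwich[OF _ _ tendsto_const])
  show "(\<lambda>n. 4 ^ n * exp (- 4 * \<eta>\<^sup>2 * real n ^ 2)) \<longlonglongrightarrow> 0"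
    using \<eta> by real_asymp
  show "\<forall>\<^sub>F n in sequentially. measure_pmf.prob (fair_coins n) {b. \<not> quasirandom \<eta> n (parcs (orientation n b))}
      \<le> 4 ^ n * exp (- 4 * \<eta>\<^sup>2 * real n ^ 2)"
    using eventually_ge_at_top[of 2]
  proof eventually_elim
    case (elim n)
    let ?bad = "\<lambda>(A, B). {b. real (card (parcs (orientation n b) \<inter> A \<times> B)) > real (card A) * real (card B) / 2 + \<eta> * real n ^ 2}"
    let ?I = "Pow {..<n} \<times> Pow {..<n}"
    have "{b. \<not> quasirandom \<eta> n (parcs (orientation n b))} = (\<Union>AB\<in>?I. ?bad AB)"
      by (auto simp: quasirandom_def not_le)
    then have "measure_pmf.prob (fair_coins n) {b. \<not> quasirandom \<eta> n (parcs (orientation n b))}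
       \<le> (\<Sum>AB\<in>?I. measure_pmf.prob (fair_coins n) (?bad AB))"
      by (simp only:) (intro measure_pmf.finite_measure_subadditive_finite, auto)
    also have "\<dots> \<le> (\<Sum>AB\<in>?I. exp (- 4 * \<eta>\<^sup>2 * real n ^ 2))"
      using prob_cut_deviation[OF elim \<eta>] by (intro sum_mono) auto
    also have "\<dots> = 4 ^ n * exp (- 4 * \<eta>\<^sup>2 * real n ^ 2)"
      by (simp add: card_cartesian_product card_Pow flip: power_mult_distrib)
    finally show ?case .
  qed
qed simp

section \<open>Greedy packing in rounds\<close>

text \<open>The product distribution splits into independent parts on \<open>S\<close> and
  \<open>I - S\<close>; \<open>P\<close> reads only the first, and \<open>Q\<close> only the second
  because \<open>S'\<close> avoids \<open>S\<close>.\<close>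

lemma prob_conj_Pi_pmf:
  assumes "finite I" "S \<subseteq> I" "S' \<subseteq> I" "S \<inter> S' = {}"
    and P: "\<And>b b'. (\<And>i. i \<in> S \<Longrightarrow> b i = b' i) \<Longrightarrow> P b = P b'"
    and Q: "\<And>b b'. (\<And>i. i \<in> S' \<Longrightarrow> b i = b' i) \<Longrightarrow> Q b = Q b'"
  shows "measure_pmf.prob (Pi_pmf I d p) {b. P b \<and> Q b}
    = measure_pmf.prob (Pi_pmf I d p) {b. P b} * measure_pmf.prob (Pi_pmf I d p) {b. Q b}"
proof -
  let ?M = "Pi_pmf S d p" and ?N = "Pi_pmf (I - S) d p"
  let ?h = "\<lambda>(f, g) x. if x \<in> S then f x else g x"
  have "I = S \<union> (I - S)" using assms(2) by blast
  then have eq: "Pi_pmf I d p = map_pmf ?h (pair_pmf ?M ?N)"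
    using Pi_pmf_union[of S "I - S" d p] assms(1,2) finite_subset by (metis Diff_disjoint finite_Diff)
  have prod: "measure_pmf.prob (pair_pmf ?M ?N) (X \<times> Y) = measure_pmf.prob ?M X * measure_pmf.prob ?N Y" for X Y
  proof -
    have "measure_pmf.prob (pair_pmf ?M ?N) (X \<times> Y)
        = measure_pmf.prob (pair_pmf ?M ?N) ((X \<times> Y) \<inter> set_pmf (pair_pmf ?M ?N))"
      by (rule measure_Int_set_pmf[symmetric])
    also have "(X \<times> Y) \<inter> set_pmf (pair_pmf ?M ?N) = (X \<inter> set_pmf ?M) \<times> (Y \<inter> set_pmf ?N)"
      by auto
    also have "measure_pmf.prob (pair_pmf ?M ?N) \<dots>
        = measure_pmf.prob ?M (X \<inter> set_pmf ?M) * measure_pmf.prob ?N (Y \<inter> set_pmf ?N)"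
      by (intro measure_pmf_prob_product countable_Int2 countable_set_pmf)
    finally show ?thesis by (simp add: measure_Int_set_pmf)
  qed
  have Ph: "P (?h (f, g)) = P f" for f g by (rule P) simp
  have Qh: "Q (?h (f, g)) = Q g" for f g by (rule Q) (use assms(4) in auto)
  have "measure_pmf.prob (Pi_pmf I d p) {b. P b \<and> Q b} = measure_pmf.prob (pair_pmf ?M ?N) ({f. P f} \<times> {g. Q g})"
    unfolding eq measure_map_pmf by (rule arg_cong[where f = "measure_pmf.prob _"]) (use Ph Qh in auto)
  moreover have "measure_pmf.prob (Pi_pmf I d p) {b. P b} = measure_pmf.prob (pair_pmf ?M ?N) ({f. P f} \<times> UNIV)"
    unfolding eq measure_map_pmf by (rule arg_cong[where f = "measure_pmf.prob _"]) (use Ph in auto)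
  moreover have "measure_pmf.prob (Pi_pmf I d p) {b. Q b} = measure_pmf.prob (pair_pmf ?M ?N) (UNIV \<times> {g. Q g})"
    unfolding eq measure_map_pmf by (rule arg_cong[where f = "measure_pmf.prob _"]) (use Qh in auto)
  ultimately show ?thesis unfolding prod by simp
qed

text \<open>By the last hypothesis the sets \<open>f e\<close> are the classes of an equivalence
  relation on \<open>U\<close>. In the application \<open>f e\<close> is the triangle through the
  arc \<open>e\<close>.\<close>

lemma card_partition_triples:
  assumes "finite U" "\<And>e. e \<in> U \<Longrightarrow> e \<in> f e \<and> f e \<subseteq> U \<and> card (f e) = 3"
    "\<And>e e'. e \<in> U \<Longrightarrow> e' \<in> f e \<Longrightarrow> f e' = f e"
  shows "disjoint (f ` U)" "\<Union>(f ` U) = U" "card U = 3 * card (f ` U)"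
proof -
  show d: "disjoint (f ` U)"
    unfolding disjoint_def using assms(3) by (metis (no_types, lifting) disjoint_iff imageE)
  show u: "\<Union>(f ` U) = U" using assms(2) by blast
  have "finite (f e)" if "e \<in> U" for e using assms(1,2) that finite_subset by blast
  then have "card (\<Union>(f ` U)) = (\<Sum>t\<in>f ` U. card t)"
    using d
    by (intro card_Union_disjoint) (auto simp: disjoint_def pairwise_def disjnt_def)
  also have "\<dots> = (\<Sum>t\<in>f ` U. 3)" using assms(2) by (intro sum.cong) auto
  finally show "card U = 3 * card (f ` U)" using u by simp
qed

text \<open>Vertices are residues modulo \<open>L\<close>. In round \<open>k\<close> the triangles \<open>x + y + z = c k\<close> modulo \<open>L\<close>
  are used: the round and two vertices determine the third, so these triangles are arc-disjoint.\<close>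

definition third_vertex :: "nat \<Rightarrow> nat \<Rightarrow> nat \<Rightarrow> nat \<Rightarrow> nat" where
  "third_vertex L c x y = nat ((int c - int x - int y) mod int L)"

primrec unused_arcs :: "nat \<Rightarrow> (nat \<Rightarrow> nat) \<Rightarrow> (nat \<times> nat) set \<Rightarrow> nat \<Rightarrow> (nat \<times> nat) set" where
  "unused_arcs L c D 0 = D"
| "unused_arcs L c D (Suc k) = {(x, y) \<in> unused_arcs L c D k.
     \<not> ((y, third_vertex L (c k) x y) \<in> unused_arcs L c D k \<and>
        (third_vertex L (c k) x y, x) \<in> unused_arcs L c D k)}"

text \<open>All constants \<open>c k\<close> will be divisible by \<open>N\<close>, so that the third vertex is \<open>- x - y\<close> modulo \<open>N\<close>;
  genericity says that the three residues modulo \<open>N\<close> are distinct.\<close>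

definition generic_pairs :: "nat \<Rightarrow> nat \<Rightarrow> (nat \<times> nat) set" where
  "generic_pairs N L = {(x, y). x < L \<and> y < L \<and> \<not> int N dvd int x - int y \<and>
     \<not> int N dvd 2 * int x + int y \<and> \<not> int N dvd int x + 2 * int y}"

lemma finite_generic_pairs: "finite (generic_pairs N L)"
  by (rule finite_subset[of _ "{..<L} \<times> {..<L}"]) (auto simp: generic_pairs_def)

lemma generic_pairs_neq: "(x, y) \<in> generic_pairs N L \<Longrightarrow> x \<noteq> y"
  by (auto simp: generic_pairs_def)

lemma third_vertex_less: "L > 0 \<Longrightarrow> third_vertex L c x y < L"
  by (simp add: third_vertex_def nat_less_iff)

lemma third_vertex_sum:
  assumes "L > 0"
  shows "int L dvd int x + int y + int (third_vertex L c x y) - int c"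
proof -
  have "int (third_vertex L c x y) = (int c - int x - int y) mod int L"
    using assms by (simp add: third_vertex_def)
  moreover have "int L dvd (int c - int x - int y) mod int L - (int c - int x - int y)"
    by (simp flip: mod_eq_dvd_iff)
  ultimately show ?thesis by (simp add: algebra_simps)
qed

lemma third_vertex_eqI:
  assumes "z < L" "int L dvd int x + int y + int z - int c"
  shows "third_vertex L c x y = z"
proof -
  have "(int c - int x - int y) mod int L = int z mod int L"
    using assms(2) by (subst mod_eq_dvd_iff) (metis (no_types, opaque_lifting) dvd_diff_commute diff_diff_eq diff_diff_eq2 add.commute)
  then show ?thesis using assms(1) by (simp add: third_vertex_def)
qed

text \<open>The congruence \<open>x + y + z = c\<close> modulo \<open>L\<close> is symmetric in the
  three vertices.\<close>

lemma third_vertex_rotate: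
  assumes "x < L" "y < L" "z = third_vertex L c x y"
  shows "third_vertex L c y z = x" "third_vertex L c z x = y"
proof -
  have "L > 0" using assms by simp
  from third_vertex_sum[OF this, of x y c] assms(3)
  have d: "int L dvd int x + int y + int z - int c" by simp
  show "third_vertex L c y z = x" "third_vertex L c z x = y"
    using d assms by (auto intro!: third_vertex_eqI simp: add_ac)
qed

text \<open>Modulo \<open>N\<close> the third vertex is \<open>- x - y\<close>. Hence
  \<open>y - z\<close> becomes \<open>x + 2 * y\<close>, \<open>2 * y + z\<close> becomes
  \<open>y - x\<close>, and so on: the three conditions are permuted up to sign.\<close>

lemma generic_third_vertex:
  assumes "(x, y) \<in> generic_pairs N L" "N dvd L" "N dvd c"
  defines "z \<equiv> third_vertex L c x y"
  shows "(y, z) \<in> generic_pairs N L" "(z, x) \<in> generic_pairs N L"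
proof -
  have L: "x < L" "y < L" "L > 0" using assms(1) by (auto simp: generic_pairs_def)
  have "int L dvd int x + int y + int z - int c"
    unfolding z_def by (rule third_vertex_sum[OF L(3)])
  then have "int N dvd int x + int y + int z - int c" using assms(2) by (meson dvd_trans int_dvd_int_iff)
  then have "int N dvd (int x + int y + int z - int c) + int c" using assms(3) by (intro dvd_add) auto
  then obtain q where q: "int x + int y + int z = int N * q" by (auto elim: dvdE)
  have z: "int z = int N * q - int x - int y" using q by simp
  have N: "int N dvd a + int N * q * b \<longleftrightarrow> int N dvd a" for a b
    by (metis dvd_add_left_iff dvd_mult_right dvd_triv_left mult.assoc)
  have "z < L" using L(3) by (simp add: z_def third_vertex_less)
  have ng: "\<not> int N dvd int x - int y" "\<not> int N dvd 2 * int x + int y" "\<not> int N dvd int x + 2 * int y"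
    using assms(1) by (auto simp: generic_pairs_def)
  have "int N dvd int y - int z \<longleftrightarrow> int N dvd int x + 2 * int y"
    using N[of "int x + 2 * int y" "-1"] by (simp add: z algebra_simps)
  moreover have "int N dvd 2 * int y + int z \<longleftrightarrow> int N dvd int x - int y"
    using N[of "int y - int x" 1] by (simp add: z algebra_simps dvd_diff_commute)
  moreover have "int N dvd int y + 2 * int z \<longleftrightarrow> int N dvd 2 * int x + int y"
    using N[of "- (2 * int x + int y)" 2] unfolding dvd_minus_iff by (simp add: z algebra_simps)
  ultimately show "(y, z) \<in> generic_pairs N L"
    using ng L \<open>z < L\<close> by (simp add: generic_pairs_def)
  have "int N dvd int z - int x \<longleftrightarrow> int N dvd 2 * int x + int y"
    using N[of "- (2 * int x + int y)" 1] unfolding dvd_minus_iff by (simp add: z algebra_simps)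
  moreover have "int N dvd 2 * int z + int x \<longleftrightarrow> int N dvd int x + 2 * int y"
    using N[of "- (int x + 2 * int y)" 2] unfolding dvd_minus_iff by (simp add: z algebra_simps)
  moreover have "int N dvd int z + 2 * int x \<longleftrightarrow> int N dvd int x - int y"
    using N[of "int x - int y" 1] by (simp add: z algebra_simps)
  ultimately show "(z, x) \<in> generic_pairs N L"
    using ng L \<open>z < L\<close> by (simp add: generic_pairs_def)
qed

lemma unused_arcs_subset: "unused_arcs L c D k \<subseteq> D"
  by (induction k) auto

lemma unused_arcs_packing:
  assumes "finite D" "D \<subseteq> generic_pairs N L" "N dvd L" "\<And>j. j < k \<Longrightarrow> N dvd c j" "D \<subseteq> parcs G"
  shows "\<exists>T. T \<subseteq> directed_triangles G \<and> disjoint T \<and> \<Union>T = D - unused_arcs L c D k \<and>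
    card D = card (unused_arcs L c D k) + 3 * card T"
  using assms(4)
proof (induction k)
  case 0
  show ?case by (intro exI[of _ "{}"]) (auto simp: disjoint_def)
next
  case (Suc k)
  then obtain T where T: "T \<subseteq> directed_triangles G" "disjoint T" "\<Union>T = D - unused_arcs L c D k"
    "card D = card (unused_arcs L c D k) + 3 * card T" by auto
  define U where "U = unused_arcs L c D k"
  define z where "z x y = third_vertex L (c k) x y" for x y
  \<comment> \<open>\<open>R\<close> consists of the arcs used in this round, and \<open>f\<close>
    sends an arc to its triangle; by rotation \<open>f\<close> takes the same value on the three
    arcs.\<close>
  define R where "R = {(x, y) \<in> U. (y, z x y) \<in> U \<and> (z x y, x) \<in> U}"
  define f where "f = (\<lambda>(x, y). {(x, y), (y, z x y), (z x y, x)})"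
  have UD: "U \<subseteq> D" unfolding U_def by (rule unused_arcs_subset)
  have finU: "finite U" using UD assms(1) finite_subset by blast
  have rot: "z y (z x y) = x" "z (z x y) x = y" "x \<noteq> y" "y \<noteq> z x y" "z x y \<noteq> x" if "(x, y) \<in> U" for x y
  proof -
    have g: "(x, y) \<in> generic_pairs N L" using that UD assms(2) by blast
    then have "x < L" "y < L" by (auto simp: generic_pairs_def)
    then show "z y (z x y) = x" "z (z x y) x = y" unfolding z_def by (auto intro: third_vertex_rotate)
    show "x \<noteq> y" using generic_pairs_neq[OF g] .
    have "N dvd c k" using Suc.prems by simp
    from generic_third_vertex[OF g assms(3) this]
    show "y \<noteq> z x y" "z x y \<noteq> x" unfolding z_def by (auto dest: generic_pairs_neq)
  qed
  have fR: "e \<in> f e \<and> f e \<subseteq> R \<and> card (f e) = 3" if "e \<in> R" for e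
  proof -
    obtain x y where e: "e = (x, y)" by fastforce
    then have "(x, y) \<in> U" "(y, z x y) \<in> U" "(z x y, x) \<in> U" using that by (auto simp: R_def)
    then show ?thesis using rot[of x y] by (auto simp: f_def R_def e)
  qed
  have ff: "f e' = f e" if "e \<in> R" "e' \<in> f e" for e e'
  proof -
    obtain x y where e: "e = (x, y)" by fastforce
    then have "(x, y) \<in> U" using that by (auto simp: R_def)
    then show ?thesis using rot[of x y] that(2) by (auto simp: f_def e)
  qed
  have finR: "finite R" using finU by (rule finite_subset[rotated]) (auto simp: R_def)
  note part = card_partition_triples[of R f, OF finR fR ff]
  have U': "unused_arcs L c D (Suc k) = U - R" by (auto simp: U_def R_def z_def)
  have RU: "R \<subseteq> U" by (auto simp: R_def)
  have disj: "\<Union>T \<inter> \<Union>(f ` R) = {}" using T(3) part(2) RU by (auto simp: U_def)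
  have ne: "{} \<notin> f ` R" using fR by auto
  show ?case
  proof (intro exI[of _ "T \<union> f ` R"] conjI)
    have "f ` R \<subseteq> directed_triangles G"
    proof (rule image_subsetI)
      fix e assume "e \<in> R"
      obtain x y where e: "e = (x, y)" by fastforce
      have "f e = {(x, y), (y, z x y), (z x y, x)}" by (simp add: f_def e)
      moreover have "(x, y) \<in> U" "f e \<subseteq> parcs G" using \<open>e \<in> R\<close> fR[OF \<open>e \<in> R\<close>] RU UD assms(5) by (auto simp: e)
      ultimately show "f e \<in> directed_triangles G"
        using rot(3-5)[of x y] unfolding directed_triangles_def by blast
    qed
    then show "T \<union> f ` R \<subseteq> directed_triangles G" using T(1) by blast
    show "disjoint (T \<union> f ` R)" using T(2) part(1) disj by (rule disjoint_union)
    show "\<Union>(T \<union> f ` R) = D - unused_arcs L c D (Suc k)"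
      using T(3) part(2) UD RU unfolding U' U_def[symmetric] by auto
    have "T \<inter> f ` R = {}" using disj ne by blast
    moreover have "finite T"
      using T(3) assms(1) by (metis finite_Diff finite_UnionD)
    ultimately have "card (T \<union> f ` R) = card T + card (f ` R)"
      using finR by (intro card_Un_disjoint) auto
    moreover have "card U = card (U - R) + card R"
      using RU finU finR by (metis card_Diff_subset card_mono le_add_diff_inverse2)
    ultimately show "card D = card (unused_arcs L c D (Suc k)) + 3 * card (T \<union> f ` R)"
      using T(4) part(3) unfolding U' U_def[symmetric] by simp
  qed
qed

section \<open>The coins on which the fate of an arc depends\<close>

text \<open>The residues of \<open>x\<close>, \<open>y\<close> and of the vertex completing them to
  sum \<open>0\<close> modulo \<open>M\<close>. As a set it is the same for both directions of a
  pair and for the three arcs of a triangle of sum \<open>0\<close>.\<close>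

definition residue_triple :: "nat \<Rightarrow> nat \<Rightarrow> nat \<Rightarrow> int set" where
  "residue_triple M x y = {int x mod int M, int y mod int M, (- int x - int y) mod int M}"

lemma residue_triple_commute: "residue_triple M x y = residue_triple M y x"
proof -
  have eq: "- int x - int y = - int y - int x" by simp
  show ?thesis unfolding residue_triple_def eq by (rule insert_commute)
qed

lemma residue_triple_coarsen:
  assumes "M' dvd M" "residue_triple M x y = residue_triple M u v"
  shows "residue_triple M' x y = residue_triple M' u v"
proof -
  have "residue_triple M' x y = (\<lambda>r. r mod int M') ` residue_triple M x y" for x y
    using assms(1) by (simp add: residue_triple_def mod_mod_cancel)
  then show ?thesis using assms(2) by simp
qed

lemma residue_triple_rotate:
  assumes "int M dvd int x + int y + int z"
  shows "residue_triple M x y = {int x mod int M, int y mod int M, int z mod int M}"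
proof -
  have "(- int x - int y) mod int M = int z mod int M"
    using assms by (subst mod_eq_dvd_iff) (metis add.commute diff_conv_add_uminus diff_diff_eq dvd_minus_iff minus_diff_eq minus_minus uminus_add_conv_diff)
  then show ?thesis by (simp add: residue_triple_def)
qed

text \<open>The three vertices sum to half the modulus, so \<open>z\<close> is not
  \<open>- x - y\<close> modulo \<open>M\<close>, although it is modulo \<open>M'\<close>. That
  \<open>z\<close> differs from \<open>x\<close> and \<open>y\<close> is seen already modulo
  \<open>N\<close>, by genericity.\<close>

lemma residue_triple_separate:
  assumes gen: "(x, y) \<in> generic_pairs N L" "(y, z) \<in> generic_pairs N L" "(z, x) \<in> generic_pairs N L"
    and M: "M = 2 * M'" "M' > 0" "N dvd M'" and sum: "int M dvd int x + int y + int z - int M'"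
  shows "int z mod int M \<notin> residue_triple M x y"
proof
  assume "int z mod int M \<in> residue_triple M x y"
  then consider "int M dvd int z - int x" | "int M dvd int z - int y" | "int M dvd int z - (- int x - int y)"
    unfolding residue_triple_def by (auto simp: mod_eq_dvd_iff)
  moreover have "N dvd M" using M by simp
  then have NM: "int M dvd a \<Longrightarrow> int N dvd a" for a by (meson dvd_trans int_dvd_int_iff)
  ultimately show False
  proof cases
    case 1 then show False using NM gen(3) by (auto simp: generic_pairs_def)
  next
    case 2 then show False using NM gen(2) by (auto simp: generic_pairs_def dvd_diff_commute)
  next
    case 3
    then have "int M dvd (int z - (- int x - int y)) - (int x + int y + int z - int M')"
      using sum by (rule dvd_diff)
    then have "int M dvd int M'" by simp
    then show False using M by (simp add: zdvd_not_zless)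
  qed
qed

text \<open>The modulus is halved in every round, from the number of residues in use at
  \<open>k = 0\<close> down to \<open>N\<close> at \<open>k = R\<close>.\<close>

definition modulus :: "nat \<Rightarrow> nat \<Rightarrow> nat \<Rightarrow> nat" where
  "modulus N R k = N * 2 ^ (R - k)"

lemma modulus_Suc: "k < R \<Longrightarrow> modulus N R k = 2 * modulus N R (Suc k)"
  by (simp add: modulus_def Suc_diff_Suc[symmetric] flip: power_Suc)

lemma modulus_dvd: "i \<le> j \<Longrightarrow> modulus N R j dvd modulus N R i"
  unfolding modulus_def by (intro mult_dvd_mono le_imp_power_dvd) auto

lemma modulus_pos: "N > 0 \<Longrightarrow> modulus N R k > 0"
  by (simp add: modulus_def)

lemma dvd_modulus: "N dvd modulus N R k"
  by (simp add: modulus_def)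

text \<open>The constant of round \<open>k\<close> is half of the current modulus (for
  \<open>k < R\<close>), and it vanishes modulo the next one.\<close>

abbreviation unused_after :: "nat \<Rightarrow> nat \<Rightarrow> (nat \<times> nat) set \<Rightarrow> nat \<Rightarrow> (nat \<times> nat) set" where
  "unused_after N R D k \<equiv> unused_arcs (modulus N R 0) (\<lambda>k. modulus N R (Suc k)) D k"

text \<open>A round combines the three arcs of a triangle whose sum vanishes modulo the next
  modulus, so their residue triples agree there. Triples modulo the current, finer modulus determine
  the coarser ones, so the induction hypothesis applies to all three arcs.\<close>

lemma unused_after_local:
  assumes "N > 0" "\<And>u v. residue_triple (modulus N R k) u v = residue_triple (modulus N R k) x y \<Longrightarrow>
      (u, v) \<in> D \<longleftrightarrow> (u, v) \<in> D'"
  shows "(x, y) \<in> unused_after N R D k \<longleftrightarrow> (x, y) \<in> unused_after N R D' k"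
  using assms(2)
proof (induction k arbitrary: x y)
  case 0
  then show ?case by simp
next
  case (Suc k)
  define M' where "M' = modulus N R (Suc k)"
  define z where "z = third_vertex (modulus N R 0) M' x y"
  have "int (modulus N R 0) dvd int x + int y + int z - int M'"
    unfolding z_def by (rule third_vertex_sum) (rule modulus_pos[OF assms(1)])
  moreover have "M' dvd modulus N R 0" unfolding M'_def by (rule modulus_dvd) simp
  ultimately have "int M' dvd int x + int y + int z - int M'" by (meson dvd_trans int_dvd_int_iff)
  then have "int M' dvd (int x + int y + int z - int M') + int M'" by (rule dvd_add) simp
  then have s: "int M' dvd int x + int y + int z" by simp
  then have s': "int M' dvd int y + int z + int x" "int M' dvd int z + int x + int y" by (simp_all add: add_ac)
  have res: "residue_triple M' y z = residue_triple M' x y" "residue_triple M' z x = residue_triple M' x y"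
    unfolding residue_triple_rotate[OF s] residue_triple_rotate[OF s'(1)] residue_triple_rotate[OF s'(2)] by auto
  have IH: "(u, v) \<in> unused_after N R D k \<longleftrightarrow> (u, v) \<in> unused_after N R D' k"
    if "residue_triple M' u v = residue_triple M' x y" for u v
  proof (rule Suc.IH)
    fix u' v' assume "residue_triple (modulus N R k) u' v' = residue_triple (modulus N R k) u v"
    moreover have "M' dvd modulus N R k" unfolding M'_def by (rule modulus_dvd) simp
    ultimately have "residue_triple M' u' v' = residue_triple M' x y"
      using residue_triple_coarsen that by metis
    then show "(u', v') \<in> D \<longleftrightarrow> (u', v') \<in> D'" using Suc.prems by (simp add: M'_def)
  qed
  show ?case
    using IH[OF refl] IH[OF res(1)] IH[OF res(2)] by (simp add: z_def M'_def)
qed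

section \<open>Survival probability of an arc\<close>

primrec survival :: "nat \<Rightarrow> real" where
  "survival 0 = 1 / 2"
| "survival (Suc k) = survival k - survival k ^ 3"

lemma survival_bounds: "0 \<le> survival k \<and> survival k \<le> 1 / 2"
proof (induction k)
  case (Suc k)
  then have b: "0 \<le> survival k" "survival k \<le> 1 / 2" by auto
  then have "survival k ^ 3 \<le> survival k" using power_decreasing[of 1 3 "survival k"] by simp
  moreover have "0 \<le> survival k ^ 3" using b(1) by (rule zero_le_power)
  ultimately have "0 \<le> survival k - survival k ^ 3" "survival k - survival k ^ 3 \<le> 1 / 2"
    using b(2) by linarith+
  then show ?case by (simp only: survival.simps)
qed simp

text \<open>The sequence decreases and is bounded below, and its limit \<open>l\<close> satisfies
  \<open>l - l^3 = l\<close>.\<close>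

lemma survival_tendsto_0: "survival \<longlonglongrightarrow> 0"
proof -
  have "decseq survival" by (rule decseq_SucI) (use survival_bounds in simp)
  then obtain l where l: "survival \<longlonglongrightarrow> l"
    using decseq_convergent[of survival 0] survival_bounds by blast
  then have "(\<lambda>k. survival (Suc k)) \<longlonglongrightarrow> l - l ^ 3" by (auto intro!: tendsto_intros)
  moreover have "(\<lambda>k. survival (Suc k)) \<longlonglongrightarrow> l" using l by (rule LIMSEQ_Suc)
  ultimately have "l - l ^ 3 = l" by (rule LIMSEQ_unique)
  then show ?thesis using l by simp
qed

text \<open>The coins read by the arcs with residue triple \<open>r\<close>; different triples give
  disjoint sets of coins.\<close>

definition residue_class :: "nat \<Rightarrow> nat \<Rightarrow> int set \<Rightarrow> (nat \<times> nat) set" where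
  "residue_class n M r = {(i, j) \<in> vertex_pairs n. residue_triple M i j = r}"

abbreviation generic_arcs :: "nat \<Rightarrow> nat \<Rightarrow> nat \<Rightarrow> (nat \<times> nat \<Rightarrow> bool) \<Rightarrow> (nat \<times> nat) set" where
  "generic_arcs N R n b \<equiv> parcs (orientation n b) \<inter> generic_pairs N (modulus N R 0)"

lemma generic_arcs_local:
  assumes "\<And>i. i \<in> residue_class n M (residue_triple M x y) \<Longrightarrow> b i = b' i"
    "residue_triple M u v = residue_triple M x y"
  shows "(u, v) \<in> generic_arcs N R n b \<longleftrightarrow> (u, v) \<in> generic_arcs N R n b'"
  using assms(1)[of "(u, v)"] assms(1)[of "(v, u)"] assms(2) residue_triple_commute[of M u v]
  by (auto simp: residue_class_def parcs_orientation_iff)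

lemma prob_arc:
  assumes "x < n" "y < n" "x \<noteq> y"
  shows "measure_pmf.prob (fair_coins n) {b. (x, y) \<in> parcs (orientation n b)} = 1 / 2"
proof -
  have coin: "measure_pmf.prob (fair_coins n) {b. b e = c} = 1 / 2" if "e \<in> vertex_pairs n" for e c
  proof -
    have "measure_pmf.prob (fair_coins n) {b. b e = c} = measure_pmf.prob (map_pmf (\<lambda>b. b e) (fair_coins n)) {c}"
      by (simp add: vimage_def)
    also have "map_pmf (\<lambda>b. b e) (fair_coins n) = bernoulli_pmf (1 / 2)"
      using that by (subst Pi_pmf_component) (auto simp: finite_vertex_pairs)
    finally show ?thesis by (cases c) (simp_all add: measure_pmf_single)
  qed
  show ?thesis
  proof (cases "x < y")
    case True
    then have "{b. (x, y) \<in> parcs (orientation n b)} = {b. b (x, y) = True}" "(x, y) \<in> vertex_pairs n"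
      using assms by (auto simp: parcs_orientation_iff vertex_pairs_def)
    then show ?thesis using coin[of "(x, y)" True] by simp
  next
    case False
    then have "{b. (x, y) \<in> parcs (orientation n b)} = {b. b (y, x) = False}" "(y, x) \<in> vertex_pairs n"
      using assms by (auto simp: parcs_orientation_iff vertex_pairs_def)
    then show ?thesis using coin[of "(y, x)" False] by simp
  qed
qed

text \<open>The three arcs of a triangle of round \<open>k + 1\<close> have distinct residue triples modulo
  \<^term>\<open>modulus N R k\<close>, so their histories up to round \<open>k\<close> read disjoint sets of coins.\<close>

lemma prob_unused_after:
  assumes N: "N > 0" and n: "modulus N R 0 \<le> n" and "k \<le> R" "(x, y) \<in> generic_pairs N (modulus N R 0)"
  shows "measure_pmf.prob (fair_coins n) {b. (x, y) \<in> unused_after N R (generic_arcs N R n b) k} = survival k"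
  using assms(3,4)
proof (induction k arbitrary: x y)
  case 0
  then have "x < n" "y < n" "x \<noteq> y" using n generic_pairs_neq by (auto simp: generic_pairs_def)
  then show ?case using prob_arc[of x n y] 0(2) by simp
next
  case (Suc k)
  let ?L = "modulus N R 0" and ?M = "modulus N R k" and ?M' = "modulus N R (Suc k)"
  let ?pr = "measure_pmf.prob (fair_coins n)"
  define E where "E u v b \<longleftrightarrow> (u, v) \<in> unused_after N R (generic_arcs N R n b) k" for u v b
  define z where "z = third_vertex ?L ?M' x y"
  have gen: "(x, y) \<in> generic_pairs N ?L" "(y, z) \<in> generic_pairs N ?L" "(z, x) \<in> generic_pairs N ?L"
    using Suc.prems(2) generic_third_vertex[OF Suc.prems(2) dvd_modulus dvd_modulus] by (auto simp: z_def)
  have M: "?M = 2 * ?M'" "?M' > 0" "N dvd ?M'"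
    using Suc.prems(1) N by (auto simp: modulus_Suc modulus_pos dvd_modulus)
  have "int ?L dvd int x + int y + int z - int ?M'"
    unfolding z_def by (rule third_vertex_sum) (rule modulus_pos[OF N])
  moreover have "?M dvd ?L" by (rule modulus_dvd) simp
  ultimately have sum: "int ?M dvd int x + int y + int z - int ?M'"
    by (meson dvd_trans int_dvd_int_iff)
  then have sum': "int ?M dvd int y + int z + int x - int ?M'" by (simp add: add_ac)
  \<comment> \<open>Two exclusions suffice: \<open>z\<close> lies in the triples of
    \<open>yz\<close> and \<open>zx\<close> but not of \<open>xy\<close>, and \<open>x\<close> lies
    in that of \<open>zx\<close> but not of \<open>yz\<close>.\<close>
  have sep: "int z mod int ?M \<notin> residue_triple ?M x y" "int x mod int ?M \<notin> residue_triple ?M y z"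
    using residue_triple_separate[OF gen M sum] residue_triple_separate[OF gen(2,3,1) M sum'] by auto
  have ne: "residue_triple ?M x y \<noteq> residue_triple ?M y z" "residue_triple ?M x y \<noteq> residue_triple ?M z x"
    "residue_triple ?M y z \<noteq> residue_triple ?M z x"
    using sep by (auto simp: residue_triple_def)
  let ?S = "\<lambda>u v. residue_class n ?M (residue_triple ?M u v)"
  have S: "?S u v \<subseteq> vertex_pairs n" for u v by (auto simp: residue_class_def)
  have S_disj: "?S x y \<inter> ?S y z = {}" "?S x y \<inter> ?S z x = {}" "?S y z \<inter> ?S z x = {}"
    using ne by (auto simp: residue_class_def)
  have local: "E u v b = E u v b'" if "\<And>i. i \<in> ?S u v \<Longrightarrow> b i = b' i" for u v b b'
    unfolding E_def by (intro unused_after_local N generic_arcs_local[OF that])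
  have IH: "?pr {b. E u v b} = survival k" if "(u, v) \<in> generic_pairs N ?L" for u v
    unfolding E_def using Suc.IH[OF _ that] Suc.prems(1) by simp
  have "?pr {b. E y z b \<and> E z x b} = ?pr {b. E y z b} * ?pr {b. E z x b}"
    by (rule prob_conj_Pi_pmf[OF finite_vertex_pairs S S S_disj(3)]) (fact local)+
  then have two: "?pr {b. E y z b \<and> E z x b} = survival k ^ 2"
    using IH gen by (simp add: power2_eq_square)
  have "?pr {b. E x y b \<and> (E y z b \<and> E z x b)} = ?pr {b. E x y b} * ?pr {b. E y z b \<and> E z x b}"
  proof (rule prob_conj_Pi_pmf[where S = "?S x y" and S' = "?S y z \<union> ?S z x"])
    show "finite (vertex_pairs n)" by (rule finite_vertex_pairs)
    show "?S x y \<subseteq> vertex_pairs n" by (rule S)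
    show "?S y z \<union> ?S z x \<subseteq> vertex_pairs n" using S by blast
    show "?S x y \<inter> (?S y z \<union> ?S z x) = {}" using S_disj by blast
    show "E x y b = E x y b'" if "\<And>i. i \<in> ?S x y \<Longrightarrow> b i = b' i" for b b' using that by (rule local)
    show "(E y z b \<and> E z x b) = (E y z b' \<and> E z x b')" if "\<And>i. i \<in> ?S y z \<union> ?S z x \<Longrightarrow> b i = b' i" for b b'
      using local[of y z b b'] local[of z x b b'] that by blast
  qed
  then have three: "?pr {b. E x y b \<and> (E y z b \<and> E z x b)} = survival k ^ 3"
    using IH[OF gen(1)] two by (simp add: power3_eq_cube power2_eq_square)
  have "{b. (x, y) \<in> unused_after N R (generic_arcs N R n b) (Suc k)}
      = {b. E x y b} - {b. E x y b \<and> (E y z b \<and> E z x b)}"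
    by (auto simp: E_def z_def)
  also have "?pr \<dots> = ?pr {b. E x y b} - ?pr {b. E x y b \<and> (E y z b \<and> E z x b)}"
    by (rule measure_pmf.finite_measure_Diff) auto
  finally show ?case using three IH[OF gen(1)] by simp
qed

section \<open>Expected size of the packing\<close>

lemma expectation_card:
  assumes "finite G" "\<And>b. X b \<subseteq> G"
  shows "measure_pmf.expectation p (\<lambda>b. real (card (X b))) = (\<Sum>e\<in>G. measure_pmf.prob p {b. e \<in> X b})"
proof -
  have "real (card (X b)) = (\<Sum>e\<in>G. indicator {b. e \<in> X b} b)" for b
    using assms by (simp add: indicator_def sum.If_cases Int_absorb1)
  then have "measure_pmf.expectation p (\<lambda>b. real (card (X b)))
      = measure_pmf.expectation p (\<lambda>b. \<Sum>e\<in>G. indicator {b. e \<in> X b} b)" by simp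
  also have "\<dots> = (\<Sum>e\<in>G. measure_pmf.expectation p (indicator {b. e \<in> X b}))"
    by (intro Bochner_Integration.integral_sum integrable_real_indicator)
       (auto simp: less_top[symmetric] measure_pmf.emeasure_finite)
  finally show ?thesis by simp
qed

text \<open>With its residue modulo \<open>N\<close> fixed, \<open>y\<close> is determined by
  \<open>y div N\<close>, which is less than \<open>K\<close>.\<close>

lemma card_residue_le:
  assumes "N > 0"
  shows "card {y. y < N * K \<and> int N dvd int y + a} \<le> K"
proof -
  let ?Y = "{y. y < N * K \<and> int N dvd int y + a}"
  have "inj_on (\<lambda>y. y div N) ?Y"
  proof (rule inj_onI)
    fix y y' assume "y \<in> ?Y" "y' \<in> ?Y" and div: "y div N = y' div N"
    then have "int N dvd (int y + a) - (int y' + a)" by (intro dvd_diff) auto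
    then have "int y mod int N = int y' mod int N" by (simp add: mod_eq_dvd_iff)
    then have "y mod N = y' mod N" by (metis of_nat_eq_iff zmod_int)
    then show "y = y'" using div by (metis div_mult_mod_eq)
  qed
  then have "card ?Y = card ((\<lambda>y. y div N) ` ?Y)" by (simp add: card_image)
  also have "\<dots> \<le> card {..<K}"
    by (intro card_mono) (auto simp: less_mult_imp_div_less mult.commute)
  finally show ?thesis by simp
qed

text \<open>Each excluded congruence has coefficient \<open>1\<close> or \<open>-1\<close> in one
  variable, so fixing the other leaves at most \<open>K\<close> solutions. For
  \<open>x + 2 * y\<close> the fixed variable is \<open>y\<close>, which avoids dividing by
  \<open>2\<close>.\<close>

lemma card_generic_pairs:
  assumes "N > 0"
  shows "real (card (generic_pairs N (N * K))) \<ge> real (N * K) ^ 2 - 3 * real K * real (N * K)"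
proof -
  let ?L = "N * K"
  define A1 where "A1 = (SIGMA x:{..<?L}. {y. y < ?L \<and> int N dvd int y + (- int x)})"
  define A2 where "A2 = (SIGMA x:{..<?L}. {y. y < ?L \<and> int N dvd int y + 2 * int x})"
  define A3 where "A3 = (SIGMA y:{..<?L}. {x. x < ?L \<and> int N dvd int x + 2 * int y})"
  have fin: "finite A1" "finite A2" "finite A3" by (simp_all add: A1_def A2_def A3_def)
  have bound: "card (SIGMA x:{..<?L}. {y. y < ?L \<and> int N dvd int y + g x}) \<le> ?L * K" for g
  proof -
    have "card (SIGMA x:{..<?L}. {y. y < ?L \<and> int N dvd int y + g x})
        = (\<Sum>x<?L. card {y. y < ?L \<and> int N dvd int y + g x})" by simp
    also have "\<dots> \<le> (\<Sum>x<?L. K)" by (intro sum_mono card_residue_le assms)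
    finally show ?thesis by simp
  qed
  have "{..<?L} \<times> {..<?L} \<subseteq> generic_pairs N ?L \<union> A1 \<union> A2 \<union> A3\<inverse>"
    by (auto simp: generic_pairs_def A1_def A2_def A3_def dvd_diff_commute add.commute)
  then have "card ({..<?L} \<times> {..<?L}) \<le> card (generic_pairs N ?L \<union> A1 \<union> A2 \<union> A3\<inverse>)"
    by (intro card_mono) (auto simp: fin finite_generic_pairs)
  also have "\<dots> \<le> card (generic_pairs N ?L) + card A1 + card A2 + card (A3\<inverse>)"
    by (meson add_le_mono1 card_Un_le order_trans)
  also have "\<dots> \<le> card (generic_pairs N ?L) + ?L * K + ?L * K + ?L * K"
    unfolding A1_def A2_def A3_def card_inverse by (intro add_mono bound order_refl)
  finally have "?L * ?L \<le> card (generic_pairs N ?L) + 3 * (?L * K)" by (simp add: card_cartesian_product)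
  then have "real (?L * ?L) \<le> real (card (generic_pairs N ?L) + 3 * (?L * K))" by (rule of_nat_mono)
  then show ?thesis by (simp add: power2_eq_square algebra_simps)
qed

text \<open>The generic arcs used up within \<open>R\<close> rounds form a triangle packing, with
  three arcs per triangle.\<close>

lemma nu_t_lower:
  assumes "N > 0"
  shows "real (card (generic_arcs N R n b)) - real (card (unused_after N R (generic_arcs N R n b) R))
    \<le> 3 * real (nu_t (orientation n b))"
proof -
  have "finite (generic_arcs N R n b)" using finite_parcs_orientation by blast
  from unused_arcs_packing[OF this, of N "modulus N R 0" R "\<lambda>k. modulus N R (Suc k)" "orientation n b"]
  obtain T where T: "T \<subseteq> directed_triangles (orientation n b)" "disjoint T"
    "card (generic_arcs N R n b) = card (unused_after N R (generic_arcs N R n b) R) + 3 * card T"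
    using dvd_modulus by auto
  from nu_t_ge[OF finite_parcs_orientation T(1,2)] T(3) show ?thesis by linarith
qed

lemma integrable_fair_coins: "integrable (measure_pmf (fair_coins n)) (f :: _ \<Rightarrow> real)"
  by (rule integrable_measure_pmf_finite)
     (auto simp: set_Pi_pmf finite_vertex_pairs intro!: finite_PiE_dflt intro: finite_subset[OF subset_UNIV])

text \<open>A generic ordered pair is a used arc with probability \<open>1 / 2 - survival R\<close>.
  Rounding \<open>n\<close> down to a multiple of \<open>2 ^ R\<close> costs at most
  \<open>2 * 2 ^ R * n\<close> pairs, and the non-generic ones cost
  \<open>3 * 2 ^ R * n\<close>.\<close>

lemma expectation_nu_t:
  assumes "2 ^ R \<le> n"
  shows "3 * measure_pmf.expectation (fair_coins n) (\<lambda>b. real (nu_t (orientation n b)))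
    \<ge> (real n ^ 2 - 5 * 2 ^ R * real n) * (1 / 2 - survival R)"
proof -
  define N where "N = n div 2 ^ R"
  define L where "L = N * 2 ^ R"
  have N: "N > 0" using assms by (simp add: N_def div_greater_zero_iff)
  have L: "L \<le> n" "n < L + 2 ^ R"
    unfolding L_def N_def
    by (simp_all add: div_times_less_eq_dividend) (metis add.commute dividend_less_div_times pos2 zero_less_power)
  have mod0: "modulus N R 0 = L" by (simp add: modulus_def L_def)
  let ?G = "generic_pairs N L"
  let ?U = "\<lambda>b. unused_after N R (generic_arcs N R n b) R"
  have E1: "measure_pmf.expectation (fair_coins n) (\<lambda>b. real (card (generic_arcs N R n b))) = real (card ?G) / 2"
  proof -
    have half: "measure_pmf.prob (fair_coins n) {b. e \<in> generic_arcs N R n b} = 1 / 2" if "e \<in> ?G" for e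
    proof -
      obtain x y where "e = (x, y)" by fastforce
      then show ?thesis
        using that prob_unused_after[OF N, of R n 0 x y] L(1) by (simp add: mod0)
    qed
    have "measure_pmf.expectation (fair_coins n) (\<lambda>b. real (card (generic_arcs N R n b)))
        = (\<Sum>e\<in>?G. measure_pmf.prob (fair_coins n) {b. e \<in> generic_arcs N R n b})"
      by (rule expectation_card[OF finite_generic_pairs]) (simp add: mod0)
    also have "\<dots> = (\<Sum>e\<in>?G. 1 / 2)" by (rule sum.cong[OF refl half])
    finally show ?thesis by simp
  qed
  have E2: "measure_pmf.expectation (fair_coins n) (\<lambda>b. real (card (?U b))) = real (card ?G) * survival R"
  proof -
    have surv: "measure_pmf.prob (fair_coins n) {b. e \<in> ?U b} = survival R" if "e \<in> ?G" for e
    proof -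
      obtain x y where "e = (x, y)" by fastforce
      then show ?thesis
        using that prob_unused_after[OF N, of R n R x y] L(1) by (simp add: mod0)
    qed
    have "?U b \<subseteq> ?G" for b
      using unused_arcs_subset[of "modulus N R 0" "\<lambda>k. modulus N R (Suc k)" "generic_arcs N R n b" R]
      by (auto simp: mod0)
    then have "measure_pmf.expectation (fair_coins n) (\<lambda>b. real (card (?U b)))
        = (\<Sum>e\<in>?G. measure_pmf.prob (fair_coins n) {b. e \<in> ?U b})"
      by (rule expectation_card[OF finite_generic_pairs])
    also have "\<dots> = (\<Sum>e\<in>?G. survival R)" by (rule sum.cong[OF refl surv])
    finally show ?thesis by simp
  qed
  have "real (card ?G) * (1 / 2 - survival R) = measure_pmf.expectation (fair_coins n)
      (\<lambda>b. real (card (generic_arcs N R n b)) - real (card (?U b)))"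
    by (subst Bochner_Integration.integral_diff) (auto simp: integrable_fair_coins E1 E2 algebra_simps)
  also have "\<dots> \<le> measure_pmf.expectation (fair_coins n) (\<lambda>b. 3 * real (nu_t (orientation n b)))"
    by (intro integral_mono integrable_fair_coins nu_t_lower N)
  also have "\<dots> = 3 * measure_pmf.expectation (fair_coins n) (\<lambda>b. real (nu_t (orientation n b)))"
    by simp
  finally have E: "real (card ?G) * (1 / 2 - survival R)
      \<le> 3 * measure_pmf.expectation (fair_coins n) (\<lambda>b. real (nu_t (orientation n b)))" .
  have "real n ^ 2 - 5 * 2 ^ R * real n \<le> real L ^ 2 - 3 * 2 ^ R * real L"
  proof -
    have "real n - 2 ^ R \<le> real L" using L(2) by (simp add: of_nat_less_iff[where ?'a = real, symmetric] del: of_nat_less_iff)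
    moreover have "real n - 2 ^ R \<ge> 0" using assms by (metis diff_ge_0_iff_ge of_nat_le_iff of_nat_numeral of_nat_power)
    ultimately have "(real n - 2 ^ R) ^ 2 \<le> real L ^ 2" by (rule power_mono)
    moreover have "real n ^ 2 - 2 * 2 ^ R * real n \<le> (real n - 2 ^ R) ^ 2"
      by (simp add: power2_diff algebra_simps)
    moreover have "2 ^ R * real L \<le> 2 ^ R * real n" using L(1) by simp
    ultimately show ?thesis by (simp only: mult.assoc)
  qed
  also have "\<dots> \<le> real (card ?G)"
    using card_generic_pairs[OF N, of "2 ^ R"] by (simp add: L_def)
  finally have "(real n ^ 2 - 5 * 2 ^ R * real n) * (1 / 2 - survival R) \<le> real (card ?G) * (1 / 2 - survival R)"
    using survival_bounds[of R] by (intro mult_right_mono) auto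
  then show ?thesis using E by linarith
qed

section \<open>Asymptotics\<close>

lemma nu_t_orientation_upper: "real (nu_t (orientation n b)) \<le> real n ^ 2 / 6"
proof -
  have "real (3 * nu_t (orientation n b)) \<le> real (card (vertex_pairs n))"
    using nu_t_upper[OF finite_parcs_orientation, of n b] unfolding card_parcs_orientation by (rule of_nat_mono)
  then have "6 * real (nu_t (orientation n b)) \<le> real n * (real n - 1)"
    by (simp add: card_vertex_pairs)
  then show ?thesis by (simp add: power2_eq_square algebra_simps)
qed

text \<open>Markov's inequality is applied to the deficit \<open>n^2 / 6 - nu_t\<close>, which is
  nonnegative by the deterministic upper bound.\<close>

lemma fair_coins_nu_t_whp:
  assumes "\<epsilon> > 0"
  shows "(\<lambda>n. measure_pmf.prob (fair_coins n)
      {b. real (nu_t (orientation n b)) < real n ^ 2 / 6 - \<epsilon> * real n ^ 2}) \<longlonglongrightarrow> 0"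
proof (rule LIMSEQ_I)
  fix r :: real assume r: "r > 0"
  \<comment> \<open>\<open>R\<close> gives \<open>survival R < r * \<epsilon>\<close>, and
    \<open>n0\<close> makes the boundary term at most \<open>r * \<epsilon> * n^2\<close>. The
    expected deficit is then at most \<open>r * \<epsilon> * n^2 / 2\<close>, so the failure
    probability is at most \<open>r / 2\<close>.\<close>
  define s where "s = min (r * \<epsilon>) (1 / 2)"
  have "s > 0" using r assms by (simp add: s_def)
  then obtain R where R: "survival R < s"
    using order_tendstoD(2)[OF survival_tendsto_0] eventually_sequentially by (metis order_refl)
  define n0 where "n0 = 2 ^ R + nat \<lceil>5 * 2 ^ R / (r * \<epsilon>)\<rceil> + 1"
  show "\<exists>n0. \<forall>n\<ge>n0. norm (measure_pmf.prob (fair_coins n)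
      {b. real (nu_t (orientation n b)) < real n ^ 2 / 6 - \<epsilon> * real n ^ 2} - 0) < r"
  proof (intro exI[of _ n0] allI impI)
    fix n assume n: "n \<ge> n0"
    let ?E = "measure_pmf.expectation (fair_coins n)"
    let ?X = "\<lambda>b. real n ^ 2 / 6 - real (nu_t (orientation n b))"
    have n': "2 ^ R \<le> n" "n > 0" using n by (auto simp: n0_def)
    have "5 * 2 ^ R / (r * \<epsilon>) \<le> real n"
      using n real_nat_ceiling_ge[of "5 * 2 ^ R / (r * \<epsilon>)"] unfolding n0_def by linarith
    then have "5 * 2 ^ R \<le> r * \<epsilon> * real n" using r assms by (simp add: field_simps)
    then have small: "5 * 2 ^ R * real n \<le> r * \<epsilon> * real n ^ 2"
      using mult_right_mono[of "5 * 2 ^ R" "r * \<epsilon> * real n" "real n"] by (simp add: power2_eq_square)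
    have nonneg: "?X b \<ge> 0" for b using nu_t_orientation_upper[of n b] by simp
    have "?E ?X = real n ^ 2 / 6 - ?E (\<lambda>b. real (nu_t (orientation n b)))"
      by (subst Bochner_Integration.integral_diff) (auto simp: integrable_fair_coins)
    also have "\<dots> \<le> real n ^ 2 / 6 - (real n ^ 2 - 5 * 2 ^ R * real n) * (1 / 2 - survival R) / 3"
      using expectation_nu_t[OF n'(1)] by linarith
    also have "\<dots> = (real n ^ 2 * survival R + 5 * 2 ^ R * real n * (1 / 2 - survival R)) / 3"
      by (simp add: field_simps)
    also have "\<dots> \<le> (real n ^ 2 * (r * \<epsilon>) + r * \<epsilon> * real n ^ 2 * (1 / 2)) / 3"
    proof (intro divide_right_mono add_mono)
      show "real n ^ 2 * survival R \<le> real n ^ 2 * (r * \<epsilon>)"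
        using R by (intro mult_left_mono) (auto simp: s_def)
      show "5 * 2 ^ R * real n * (1 / 2 - survival R) \<le> r * \<epsilon> * real n ^ 2 * (1 / 2)"
        by (rule mult_mono[OF small]) (use survival_bounds[of R] r assms in auto)
    qed simp
    also have "\<dots> = r * (\<epsilon> * real n ^ 2) / 2" by (simp add: field_simps)
    finally have E: "?E ?X \<le> r * (\<epsilon> * real n ^ 2) / 2" .
    have pos: "\<epsilon> * real n ^ 2 > 0" using assms n' by simp
    have "measure_pmf.prob (fair_coins n) {b. real (nu_t (orientation n b)) < real n ^ 2 / 6 - \<epsilon> * real n ^ 2}
        \<le> measure_pmf.prob (fair_coins n) {b \<in> space (measure_pmf (fair_coins n)). ?X b \<ge> \<epsilon> * real n ^ 2}"
      by (intro measure_pmf.finite_measure_mono) auto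
    also have "\<dots> \<le> ?E ?X / (\<epsilon> * real n ^ 2)"
      by (rule integral_Markov_inequality_measure[where A = UNIV])
         (use integrable_fair_coins nonneg pos in auto)
    also have "\<dots> \<le> r * (\<epsilon> * real n ^ 2) / 2 / (\<epsilon> * real n ^ 2)"
      using E pos by (intro divide_right_mono) auto
    also have "\<dots> = r / 2" using n'(2) assms by simp
    finally show "norm (measure_pmf.prob (fair_coins n)
      {b. real (nu_t (orientation n b)) < real n ^ 2 / 6 - \<epsilon> * real n ^ 2} - 0) < r"
      using r by simp
  qed
qed

text \<open>In a quasirandom tournament the triangle-free remainder \<open>H\<close> keeps at most
  \<open>(1 / 4 + \<epsilon> / 2) * n^2\<close> of the \<open>n * (n - 1) / 2\<close> arcs. The
  other half of \<open>\<epsilon>\<close> absorbs the term \<open>n / 2\<close> once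
  \<open>n \<ge> 1 / \<epsilon>\<close>.\<close>

lemma fair_coins_tau_t_whp:
  assumes "\<epsilon> > 0"
  shows "(\<lambda>n. measure_pmf.prob (fair_coins n)
      {b. real (tau_t (orientation n b)) < real n ^ 2 / 4 - \<epsilon> * real n ^ 2}) \<longlonglongrightarrow> 0"
proof -
  have "\<epsilon> / 2 > 0" using assms by simp
  from triangle_free_subset_of_quasirandom[OF this, where 'a = nat] obtain \<eta> n0 where \<eta>: "\<eta> > 0"
    and size: "\<forall>V (T :: (nat \<times> nat) set) H. finite V \<longrightarrow> card V \<ge> n0 \<longrightarrow> H \<subseteq> T \<longrightarrow> H \<subseteq> V \<times> V \<longrightarrow>
      (\<forall>x y z. \<not> ((x, y) \<in> H \<and> (y, z) \<in> H \<and> (z, x) \<in> H)) \<longrightarrow>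
      (\<forall>A B. A \<subseteq> V \<longrightarrow> B \<subseteq> V \<longrightarrow>
        real (card (T \<inter> A \<times> B)) \<le> real (card A) * real (card B) / 2 + \<eta> * real (card V) ^ 2) \<longrightarrow>
      real (card H) \<le> (1 / 4 + \<epsilon> / 2) * real (card V) ^ 2"
    by (elim exE conjE) (rule that)
  have lower: "real (tau_t (orientation n b)) \<ge> real n ^ 2 / 4 - \<epsilon> * real n ^ 2"
    if n: "n \<ge> n0" "real n \<ge> 1 / \<epsilon>" and qr: "quasirandom \<eta> n (parcs (orientation n b))" for n b
  proof -
    let ?P = "parcs (orientation n b)"
    obtain F where F: "F \<subseteq> ?P" "directed_triangles ((orientation n b)\<lparr>parcs := ?P - F\<rparr>) = {}"
      "tau_t (orientation n b) = card F"
      using tau_t_attained[OF finite_parcs_orientation] by blast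
    define H where "H = ?P - F"
    have free: "\<forall>x y z. \<not> ((x, y) \<in> H \<and> (y, z) \<in> H \<and> (z, x) \<in> H)"
    proof (intro allI notI)
      fix x y z
      assume a: "(x, y) \<in> H \<and> (y, z) \<in> H \<and> (z, x) \<in> H"
      then have "x \<noteq> y \<and> y \<noteq> z \<and> z \<noteq> x"
        by (auto simp: H_def parcs_orientation_iff vertex_pairs_def)
      with a have "{(x, y), (y, z), (z, x)} \<in> directed_triangles ((orientation n b)\<lparr>parcs := H\<rparr>)"
        unfolding directed_triangles_def by auto
      then show False using F(2) by (simp add: H_def)
    qed
    have H: "H \<subseteq> ?P" "H \<subseteq> {..<n} \<times> {..<n}"
      using parcs_orientation_subset[of n b] by (auto simp: H_def)
    have "\<forall>A B. A \<subseteq> {..<n} \<longrightarrow> B \<subseteq> {..<n} \<longrightarrow>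
        real (card (?P \<inter> A \<times> B)) \<le> real (card A) * real (card B) / 2 + \<eta> * real (card {..<n}) ^ 2"
      using qr by (simp only: quasirandom_def card_lessThan)
    moreover have "n0 \<le> card {..<n}" using n(1) by simp
    ultimately have "real (card H) \<le> (1 / 4 + \<epsilon> / 2) * real (card {..<n}) ^ 2"
      using size free H finite_lessThan[of n] by blast
    moreover have "card ?P = card F + card H"
      unfolding H_def using F(1) finite_parcs_orientation[of n b]
      by (metis card_Diff_subset card_mono finite_subset le_add_diff_inverse)
    then have "real n * (real n - 1) / 2 = real (card F) + real (card H)"
      using card_vertex_pairs[of n] by (simp add: card_parcs_orientation)
    moreover have "real n \<le> \<epsilon> * real n ^ 2"
    proof -
      have "1 \<le> \<epsilon> * real n" using n(2) assms by (simp add: field_simps)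
      then have "1 * real n \<le> \<epsilon> * real n * real n" by (rule mult_right_mono) simp
      then show ?thesis by (simp add: power2_eq_square mult.assoc)
    qed
    moreover have "real n * (real n - 1) / 2 = real n ^ 2 / 2 - real n / 2"
      by (simp add: power2_eq_square field_simps)
    moreover have "(1 / 4 + \<epsilon> / 2) * real (card {..<n}) ^ 2 = real n ^ 2 / 4 + \<epsilon> * real n ^ 2 / 2"
      by (simp add: algebra_simps)
    ultimately show ?thesis unfolding F(3) by linarith
  qed
  show ?thesis
  proof (rule tendsto_sandwich[OF _ _ tendsto_const quasirandom_whp[OF \<eta>]])
    show "\<forall>\<^sub>F n in sequentially. measure_pmf.prob (fair_coins n)
        {b. real (tau_t (orientation n b)) < real n ^ 2 / 4 - \<epsilon> * real n ^ 2}
      \<le> measure_pmf.prob (fair_coins n) {b. \<not> quasirandom \<eta> n (parcs (orientation n b))}"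
      using eventually_ge_at_top[of n0] eventually_ge_at_top[of "nat \<lceil>1 / \<epsilon>\<rceil>"]
    proof eventually_elim
      case (elim n)
      have "real n \<ge> 1 / \<epsilon>" using elim(2) by linarith
      then have "\<not> quasirandom \<eta> n (parcs (orientation n b))"
        if "real (tau_t (orientation n b)) < real n ^ 2 / 4 - \<epsilon> * real n ^ 2" for b
        using lower[OF elim(1), of b] that by linarith
      then show ?case by (intro measure_pmf.finite_measure_mono) auto
    qed
  qed simp
qed

section \<open>From fixed errors to one vanishing error\<close>

text \<open>At \<open>n\<close> take the largest \<open>j \<le> n\<close> for which
  \<open>p (1 / (j + 1)) n\<close> is at most \<open>1 / (j + 1)\<close>. Every fixed index is
  admissible for all large \<open>n\<close>, so the chosen one tends to infinity.\<close>

lemma diagonal_null_sequence: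
  fixes p :: "real \<Rightarrow> nat \<Rightarrow> real"
  assumes lim: "\<And>\<epsilon>. \<epsilon> > 0 \<Longrightarrow> p \<epsilon> \<longlonglongrightarrow> 0" and nonneg: "\<And>\<epsilon> n. p \<epsilon> n \<ge> 0"
  shows "\<exists>e. e \<longlonglongrightarrow> 0 \<and> (\<lambda>n. p (e n) n) \<longlonglongrightarrow> 0"
proof -
  define good where "good n = {j. j \<le> n \<and> p (1 / Suc j) n \<le> 1 / Suc j}" for n
  \<comment> \<open>The cap \<open>j \<le> n\<close> makes the maximum exist; the default
    \<open>0\<close> occurs for only finitely many \<open>n\<close>.\<close>
  define j where "j n = (if good n = {} then 0 else Max (good n))" for n
  define e where "e n = 1 / real (Suc (j n))" for n
  have fin: "finite (good n)" for n unfolding good_def by (rule finite_subset[of _ "{..n}"]) auto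
  have ev: "eventually (\<lambda>n. j n \<ge> i \<and> p (e n) n \<le> 1 / Suc (j n)) sequentially" for i
  proof -
    have "eventually (\<lambda>n. p (1 / Suc i) n < 1 / Suc i) sequentially"
      using lim[of "1 / Suc i"] by (intro order_tendstoD) auto
    then show ?thesis using eventually_ge_at_top[of i]
    proof eventually_elim
      case (elim n)
      then have i: "i \<in> good n" by (simp add: good_def)
      then have ne: "good n \<noteq> {}" by auto
      then have "j n = Max (good n)" by (simp add: j_def)
      then have "j n \<in> good n" "j n \<ge> i" using Max_in[OF fin ne] Max_ge[OF fin i] by auto
      then show ?case by (simp add: good_def e_def)
    qed
  qed
  have "filterlim j at_top sequentially"
    unfolding filterlim_at_top by (intro allI eventually_mono[OF ev]) auto
  then have e0: "e \<longlonglongrightarrow> 0"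
    unfolding e_def by (intro LIMSEQ_inverse_real_of_nat[THEN filterlim_compose, unfolded inverse_eq_divide])
  moreover have "(\<lambda>n. p (e n) n) \<longlonglongrightarrow> 0"
  proof (rule tendsto_sandwich[OF _ _ tendsto_const e0])
    show "\<forall>\<^sub>F n in sequentially. p (e n) n \<le> e n"
      using ev[of 0] by eventually_elim (simp add: e_def)
  qed (simp add: nonneg)
  ultimately show ?thesis by blast
qed

theorem theorem9:
  shows "\<exists>f g :: nat \<Rightarrow> real.
    f \<in> o(\<lambda>n. real n ^ 2) \<and> g \<in> o(\<lambda>n. real n ^ 2) \<and>
    (\<lambda>n. measure_pmf.prob (random_tournament n)
       {D. \<bar>real (nu_t D) - real n ^ 2 / 6\<bar> \<le> f n \<and>
           real n ^ 2 / 4 - g n \<le> real (tau_t D) \<and> real (tau_t D) \<le> real n ^ 2 / 4})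
      \<longlonglongrightarrow> 1"
proof -
  let ?nu = "\<lambda>n b. real (nu_t (orientation n b))" and ?tau = "\<lambda>n b. real (tau_t (orientation n b))"
  \<comment> \<open>This bounds the probability that one of the two lower bounds fails; the upper
    bounds hold for every outcome.\<close>
  define p where "p \<epsilon> n = measure_pmf.prob (fair_coins n) {b. ?nu n b < real n ^ 2 / 6 - \<epsilon> * real n ^ 2}
    + measure_pmf.prob (fair_coins n) {b. ?tau n b < real n ^ 2 / 4 - \<epsilon> * real n ^ 2}" for \<epsilon> n
  have "p \<epsilon> \<longlonglongrightarrow> 0" if "\<epsilon> > 0" for \<epsilon>
    unfolding p_def using tendsto_add[OF fair_coins_nu_t_whp[OF that] fair_coins_tau_t_whp[OF that]] by simp
  from diagonal_null_sequence[of p, OF this] obtain e where e: "e \<longlonglongrightarrow> 0" "(\<lambda>n. p (e n) n) \<longlonglongrightarrow> 0"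
    by (auto simp: p_def)
  \<comment> \<open>The same error function is the witness for both \<open>f\<close> and
    \<open>g\<close>.\<close>
  define f where "f n = e n * real n ^ 2" for n
  have "f \<in> o(\<lambda>n. real n ^ 2)"
  proof (rule smalloI_tendsto)
    have "eventually (\<lambda>n. e n = f n / real n ^ 2) sequentially"
      using eventually_gt_at_top[of 0] by eventually_elim (simp add: f_def)
    from Lim_transform_eventually[OF e(1) this]
    show "(\<lambda>n. f n / real n ^ 2) \<longlonglongrightarrow> 0" .
    show "\<forall>\<^sub>F n in sequentially. real n ^ 2 \<noteq> 0"
      using eventually_gt_at_top[of 0] by eventually_elim simp
  qed
  moreover have "(\<lambda>n. measure_pmf.prob (random_tournament n)
       {D. \<bar>real (nu_t D) - real n ^ 2 / 6\<bar> \<le> f n \<and>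
           real n ^ 2 / 4 - f n \<le> real (tau_t D) \<and> real (tau_t D) \<le> real n ^ 2 / 4}) \<longlonglongrightarrow> 1"
  proof (rule tendsto_sandwich)
    show "(\<lambda>n. 1 - p (e n) n) \<longlonglongrightarrow> 1" using tendsto_diff[OF tendsto_const e(2), of 1] by simp
    show "\<forall>\<^sub>F n in sequentially. 1 - p (e n) n \<le> measure_pmf.prob (random_tournament n)
       {D. \<bar>real (nu_t D) - real n ^ 2 / 6\<bar> \<le> f n \<and>
           real n ^ 2 / 4 - f n \<le> real (tau_t D) \<and> real (tau_t D) \<le> real n ^ 2 / 4}"
    proof (rule always_eventually, rule allI)
      fix n
      let ?A = "{b. ?nu n b < real n ^ 2 / 6 - f n}" and ?B = "{b. ?tau n b < real n ^ 2 / 4 - f n}"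
      let ?C = "{b. \<bar>?nu n b - real n ^ 2 / 6\<bar> \<le> f n \<and> real n ^ 2 / 4 - f n \<le> ?tau n b \<and> ?tau n b \<le> real n ^ 2 / 4}"
      let ?pr = "measure_pmf.prob (fair_coins n)"
      have "b \<in> ?C \<union> ?A \<union> ?B" for b
      proof -
        have "?nu n b \<le> real n ^ 2 / 6" "?tau n b \<le> real n ^ 2 / 4"
          by (rule nu_t_orientation_upper, rule tau_t_orientation_upper)
        then show ?thesis by (auto simp: abs_le_iff)
      qed
      then have "?C \<union> ?A \<union> ?B = UNIV" by blast
      then have "1 = ?pr (?C \<union> ?A \<union> ?B)" by simp
      also have "\<dots> \<le> ?pr (?C \<union> ?A) + ?pr ?B" by (rule measure_Un_le) auto
      also have "?pr (?C \<union> ?A) \<le> ?pr ?C + ?pr ?A" by (rule measure_Un_le) auto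
      finally have "1 - p (e n) n \<le> ?pr ?C" by (simp add: p_def f_def)
      then show "1 - p (e n) n \<le> measure_pmf.prob (random_tournament n)
       {D. \<bar>real (nu_t D) - real n ^ 2 / 6\<bar> \<le> f n \<and>
           real n ^ 2 / 4 - f n \<le> real (tau_t D) \<and> real (tau_t D) \<le> real n ^ 2 / 4}"
        by (simp add: random_tournament_def vimage_def)
    qed
  qed auto
  ultimately show ?thesis by blast
qed

end
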